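(* Let $A$ be a unital $C^*$-algebra, $\Gamma$ a discrete group, and $\alpha:\Gamma\to\mathrm{Aut}(A)$ a group homomorphism. A $\Gamma$-invariant state $\varphi$ on $A$ is ergodic if and only if $\varphi(T^*T)=|\varphi(T)|^2$ for every $T\in B(L^2(A,\varphi))_\Gamma\cap\pi_\varphi(A)'$.
   Context: A state $\varphi$ on $A$ is $\Gamma$-invariant if $\varphi(\alpha_s(a))=\varphi(a)$ for all $s\in\Gamma$, $a\in A$; it is ergodic if it is an extreme point of the convex set of all $\Gamma$-invariant states on $A$. For a $\Gamma$-invariant state $\varphi$, $\pi_\varphi:A\to B(L^2(A,\varphi))$ is the GNS representation, $\hat a$ is the image of $a\in A$ in $L^2(A,\varphi)$, and $U_\varphi$ is the unitary representation of $\Gamma$ on $L^2(A,\varphi)$ with $U_\varphi(s)\hat a=\widehat{\alpha_s(a)}$. For $T\in B(L^2(A,\varphi))$ write $\varphi(T)=\langle T\hat1,\hat1\rangle$. $B(L^2(A,\varphi))_\Gamma$ is the set of $T\in B(L^2(A,\varphi))$ with $U_\varphi(s)TU_\varphi(s^{-1})=T$ for all $s\in\Gamma$, and $\pi_\varphi(A)'=\{T\in B(L^2(A,\varphi)): T\pi_\varphi(a)=\pi_\varphi(a)T\text{ for all }a\in A\}$. *)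

theory Defs
  imports "HOL-Analysis.Analysis" "HOL-Algebra.Group"
begin

text \<open>Unital C*-algebras. The real scalar multiplication of the class
  \<open>real_normed_algebra_1\<close> is the restriction of the complex one. That class has
  \<open>0 \<noteq> 1\<close>, which only leaves out the zero algebra; the zero algebra has no states.\<close>

class cstar_algebra_1 = real_normed_algebra_1 + banach +
  fixes scaleC :: "complex \<Rightarrow> 'a \<Rightarrow> 'a" (infixr \<open>*\<^sub>C\<close> 75)
    and star :: "'a \<Rightarrow> 'a"
  assumes scaleC_add_right: "c *\<^sub>C (x + y) = c *\<^sub>C x + c *\<^sub>C y"
    and scaleC_add_left: "(c + d) *\<^sub>C x = c *\<^sub>C x + d *\<^sub>C x"
    and scaleC_scaleC: "c *\<^sub>C (d *\<^sub>C x) = (c * d) *\<^sub>C x"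
    and scaleC_of_real: "complex_of_real r *\<^sub>C x = r *\<^sub>R x"
    and mult_scaleC_left: "(c *\<^sub>C x) * y = c *\<^sub>C (x * y)"
    and mult_scaleC_right: "x * (c *\<^sub>C y) = c *\<^sub>C (x * y)"
    and norm_scaleC: "norm (c *\<^sub>C x) = cmod c * norm x"
    and star_star: "star (star x) = x"
    and star_add: "star (x + y) = star x + star y"
    and star_scaleC: "star (c *\<^sub>C x) = cnj c *\<^sub>C star x"
    and star_mult: "star (x * y) = star y * star x"
    and norm_star_mult_self: "norm (star x * x) = (norm x)\<^sup>2"

definition star_automorphism :: "('a::cstar_algebra_1 \<Rightarrow> 'a) \<Rightarrow> bool" where
  "star_automorphism f \<longleftrightarrow> bij f
     \<and> (\<forall>a b. f (a + b) = f a + f b)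
     \<and> (\<forall>c a. f (c *\<^sub>C a) = c *\<^sub>C f a)
     \<and> (\<forall>a b. f (a * b) = f a * f b)
     \<and> (\<forall>a. f (star a) = star (f a))"

definition Aut_group :: "('a::cstar_algebra_1 \<Rightarrow> 'a) monoid" where
  "Aut_group = \<lparr>carrier = {f. star_automorphism f}, mult = (\<circ>), one = id\<rparr>"

text \<open>States are taken in the Banach space of bounded real-linear maps
  \<open>'a \<Rightarrow>\<^sub>L complex\<close>, with complex linearity as an explicit condition, so that
  \<open>extreme_point_of\<close> applies. Boundedness is no restriction: positive functionals
  on a C*-algebra are bounded.\<close>

definition is_state :: "('a::cstar_algebra_1 \<Rightarrow>\<^sub>L complex) \<Rightarrow> bool" where
  "is_state \<phi> \<longleftrightarrow>
     (\<forall>c a. blinfun_apply \<phi> (c *\<^sub>C a) = c * blinfun_apply \<phi> a)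
     \<and> (\<forall>a. blinfun_apply \<phi> (star a * a) \<in> \<real>\<^sub>\<ge>\<^sub>0)
     \<and> blinfun_apply \<phi> 1 = 1"

definition invariant_states ::
  "('g, 'm) monoid_scheme \<Rightarrow> ('g \<Rightarrow> 'a::cstar_algebra_1 \<Rightarrow> 'a) \<Rightarrow> ('a \<Rightarrow>\<^sub>L complex) set" where
  "invariant_states \<Gamma> \<alpha> =
     {\<phi>. is_state \<phi> \<and> (\<forall>s\<in>carrier \<Gamma>. \<forall>a. blinfun_apply \<phi> (\<alpha> s a) = blinfun_apply \<phi> a)}"

definition ergodic_state ::
  "('g, 'm) monoid_scheme \<Rightarrow> ('g \<Rightarrow> 'a::cstar_algebra_1 \<Rightarrow> 'a) \<Rightarrow> ('a \<Rightarrow>\<^sub>L complex) \<Rightarrow> bool" where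
  "ergodic_state \<Gamma> \<alpha> \<phi> \<longleftrightarrow> \<phi> extreme_point_of (invariant_states \<Gamma> \<alpha>)"

text \<open>Complex inner product spaces with an explicit carrier: \<open>L\<^sup>2(A, \<phi>)\<close> depends
  on \<open>\<phi>\<close>, so it cannot be a type. Inner products are linear in the first argument.\<close>

record 'h inner_space = "'h partial_object" +
  vadd :: "'h \<Rightarrow> 'h \<Rightarrow> 'h"
  vscale :: "complex \<Rightarrow> 'h \<Rightarrow> 'h"
  vinner :: "'h \<Rightarrow> 'h \<Rightarrow> complex"

definition vnorm :: "('h, 'm) inner_space_scheme \<Rightarrow> 'h \<Rightarrow> real" where
  "vnorm H \<xi> = sqrt (Re (vinner H \<xi> \<xi>))"

text \<open>Operators are extensional functions, so that equality of operators is equality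
  on the carrier.\<close>

definition bounded_ops :: "('h, 'm) inner_space_scheme \<Rightarrow> ('h \<Rightarrow> 'h) set" where
  "bounded_ops H = {T \<in> carrier H \<rightarrow>\<^sub>E carrier H.
     (\<forall>\<xi>\<in>carrier H. \<forall>\<eta>\<in>carrier H. T (vadd H \<xi> \<eta>) = vadd H (T \<xi>) (T \<eta>))
     \<and> (\<forall>c. \<forall>\<xi>\<in>carrier H. T (vscale H c \<xi>) = vscale H c (T \<xi>))
     \<and> (\<exists>K. \<forall>\<xi>\<in>carrier H. vnorm H (T \<xi>) \<le> K * vnorm H \<xi>)}"

definition op_adjoint :: "('h, 'm) inner_space_scheme \<Rightarrow> ('h \<Rightarrow> 'h) \<Rightarrow> 'h \<Rightarrow> 'h" where
  "op_adjoint H T = (THE S. S \<in> bounded_ops H \<and>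
     (\<forall>\<xi>\<in>carrier H. \<forall>\<eta>\<in>carrier H. vinner H (T \<xi>) \<eta> = vinner H \<xi> (S \<eta>)))"

text \<open>\<open>L\<^sup>2(A, \<phi>)\<close> is the completion of \<open>A\<close> for the seminorm \<open>\<phi>(a\<^sup>*a)\<^bsup>1/2\<^esup>\<close>: Cauchy
  sequences in \<open>A\<close> modulo sequences tending to zero. This also divides out the
  null space of the seminorm.\<close>

definition gns_seminorm :: "('a::cstar_algebra_1 \<Rightarrow>\<^sub>L complex) \<Rightarrow> 'a \<Rightarrow> real" where
  "gns_seminorm \<phi> a = sqrt (Re (blinfun_apply \<phi> (star a * a)))"

definition gns_Cauchy :: "('a::cstar_algebra_1 \<Rightarrow>\<^sub>L complex) \<Rightarrow> (nat \<Rightarrow> 'a) set" where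
  "gns_Cauchy \<phi> = {x. \<forall>e>0. \<exists>N. \<forall>m\<ge>N. \<forall>n\<ge>N. gns_seminorm \<phi> (x m - x n) < e}"

definition gns_rel :: "('a::cstar_algebra_1 \<Rightarrow>\<^sub>L complex) \<Rightarrow> ((nat \<Rightarrow> 'a) \<times> (nat \<Rightarrow> 'a)) set" where
  "gns_rel \<phi> = {(x, y). x \<in> gns_Cauchy \<phi> \<and> y \<in> gns_Cauchy \<phi>
     \<and> (\<lambda>n. gns_seminorm \<phi> (x n - y n)) \<longlonglongrightarrow> 0}"

definition L2 :: "('a::cstar_algebra_1 \<Rightarrow>\<^sub>L complex) \<Rightarrow> (nat \<Rightarrow> 'a) set inner_space" where
  "L2 \<phi> = \<lparr>carrier = gns_Cauchy \<phi> // gns_rel \<phi>,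
     vadd = (\<lambda>\<xi> \<eta>. \<Union>x\<in>\<xi>. \<Union>y\<in>\<eta>. gns_rel \<phi> `` {\<lambda>n. x n + y n}),
     vscale = (\<lambda>c \<xi>. \<Union>x\<in>\<xi>. gns_rel \<phi> `` {\<lambda>n. c *\<^sub>C x n}),
     vinner = (\<lambda>\<xi> \<eta>. THE z. \<forall>x\<in>\<xi>. \<forall>y\<in>\<eta>.
       (\<lambda>n. blinfun_apply \<phi> (star (y n) * x n)) \<longlonglongrightarrow> z)\<rparr>"

definition gns_hat :: "('a::cstar_algebra_1 \<Rightarrow>\<^sub>L complex) \<Rightarrow> 'a \<Rightarrow> (nat \<Rightarrow> 'a) set" where
  "gns_hat \<phi> a = gns_rel \<phi> `` {\<lambda>n. a}"

definition gns_rep ::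
  "('a::cstar_algebra_1 \<Rightarrow>\<^sub>L complex) \<Rightarrow> 'a \<Rightarrow> (nat \<Rightarrow> 'a) set \<Rightarrow> (nat \<Rightarrow> 'a) set" where
  "gns_rep \<phi> a = (THE T. T \<in> bounded_ops (L2 \<phi>) \<and>
     (\<forall>b. T (gns_hat \<phi> b) = gns_hat \<phi> (a * b)))"

definition gns_unitary ::
  "('g \<Rightarrow> 'a::cstar_algebra_1 \<Rightarrow> 'a) \<Rightarrow> ('a \<Rightarrow>\<^sub>L complex) \<Rightarrow> 'g
     \<Rightarrow> (nat \<Rightarrow> 'a) set \<Rightarrow> (nat \<Rightarrow> 'a) set" where
  "gns_unitary \<alpha> \<phi> s = (THE T. T \<in> bounded_ops (L2 \<phi>) \<and>
     (\<forall>a. T (gns_hat \<phi> a) = gns_hat \<phi> (\<alpha> s a)))"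

definition gns_expect ::
  "('a::cstar_algebra_1 \<Rightarrow>\<^sub>L complex) \<Rightarrow> ((nat \<Rightarrow> 'a) set \<Rightarrow> (nat \<Rightarrow> 'a) set) \<Rightarrow> complex" where
  "gns_expect \<phi> T = vinner (L2 \<phi>) (T (gns_hat \<phi> 1)) (gns_hat \<phi> 1)"

definition invariant_ops ::
  "('g, 'm) monoid_scheme \<Rightarrow> ('g \<Rightarrow> 'a::cstar_algebra_1 \<Rightarrow> 'a) \<Rightarrow> ('a \<Rightarrow>\<^sub>L complex)
     \<Rightarrow> ((nat \<Rightarrow> 'a) set \<Rightarrow> (nat \<Rightarrow> 'a) set) set" where
  "invariant_ops \<Gamma> \<alpha> \<phi> = {T \<in> bounded_ops (L2 \<phi>). \<forall>s\<in>carrier \<Gamma>. \<forall>\<xi>\<in>carrier (L2 \<phi>).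
     gns_unitary \<alpha> \<phi> s (T (gns_unitary \<alpha> \<phi> (inv\<^bsub>\<Gamma>\<^esub> s) \<xi>)) = T \<xi>}"

definition gns_commutant ::
  "('a::cstar_algebra_1 \<Rightarrow>\<^sub>L complex) \<Rightarrow> ((nat \<Rightarrow> 'a) set \<Rightarrow> (nat \<Rightarrow> 'a) set) set" where
  "gns_commutant \<phi> = {T \<in> bounded_ops (L2 \<phi>). \<forall>a. \<forall>\<xi>\<in>carrier (L2 \<phi>).
     T (gns_rep \<phi> a \<xi>) = gns_rep \<phi> a (T \<xi>)}"

end

(* Domination of invariant states is a Radon-Nikodym correspondence with the invariant part of
   the commutant. If chi <= C phi is invariant, the form (a, b) |-> chi(b* a) is given by some
   T in the invariant commutant, and equality in Cauchy-Schwarz for T 1 and 1 forces T 1 = 1,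
   that is chi = phi. Conversely, for T in the invariant commutant and c complex put
   xi = T 1 + c 1; the functional a |-> <pi(a) xi, xi> is invariant and dominated by a multiple
   of phi, so for ergodic phi it is a multiple of phi. Polarising in c gives T 1 = <T 1, 1> 1. *)
theory Submission
  imports Defs
begin

section \<open>Complex and star algebra identities\<close>

text \<open>Commuting with \<open>gns_rep\<close> gives T a = \<pi>(a) T 1 for a in A, so T is
  determined by the vector T 1, and an operator bound K for T becomes |\<pi>(a) \<xi>| \<le> (K +
  |c|) s(a) with s the seminorm of \<phi>. This is where the domination comes from. The parameter c
  admits arbitrary T, neither positive nor self-adjoint: a single vector functional is quadratic in
  T 1, and varying c isolates its linear part. Since 1 is a unit vector, the condition on T compares
  |T 1| with |<T 1, 1>|. Extremality is used through domination in both directions: an end point of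
  a segment through \<phi> is dominated by a multiple of \<phi>, and a dominated state leaves a
  positive remainder. The space depends on \<phi>, so it is a set of classes instead of a type.
  Riesz representation, adjoints and the operators given by definite descriptions are therefore
  built on that carrier, by computing with Cauchy sequences in A and passing to limits.\<close>

lemma scaleC_zero_left: "0 *\<^sub>C x = (0::'a::cstar_algebra_1)"
  using scaleC_of_real[of 0 x] by simp

lemma scaleC_minus_one: "(-1) *\<^sub>C x = - (x::'a::cstar_algebra_1)"
  using scaleC_of_real[of "-1" x] by simp

lemma scaleC_minus_right: "c *\<^sub>C (- x) = - (c *\<^sub>C (x::'a::cstar_algebra_1))"
  by (metis mult.commute scaleC_minus_one scaleC_scaleC)

lemma scaleC_diff_right: "c *\<^sub>C (x - y) = c *\<^sub>C x - c *\<^sub>C (y::'a::cstar_algebra_1)"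
  using scaleC_add_right[of c x "- y"] by (simp add: scaleC_minus_right)

lemma star_minus: "star (- x) = - star (x::'a::cstar_algebra_1)"
  using star_scaleC[of "-1" x] by (simp add: scaleC_minus_one)

lemma star_diff: "star (x - y) = star x - star (y::'a::cstar_algebra_1)"
  using star_add[of x "- y"] by (simp add: star_minus)

lemma star_one: "star 1 = (1::'a::cstar_algebra_1)"
  using star_mult[of "star (1::'a)" 1] by (simp add: star_star)

lemma star_power: "star (x ^ n) = star (x::'a::cstar_algebra_1) ^ n"
  by (induction n) (simp_all add: star_one star_mult power_commutes)

text \<open>If \<open>r > M > 0\<close>, the powers of \<open>r / M\<close> outgrow
  \<open>C\<close>; for \<open>M = 0\<close> the exponent \<open>2 ^ 0 = 1\<close> already decides.
  A crude constant \<open>C\<close> thus disappears after taking roots of order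
  \<open>2 ^ n\<close>, which is how \<open>sn_mult_le\<close> obtains a sharp bound.\<close>

lemma le_if_power_two_power_le:
  fixes r M :: real
  assumes "M \<ge> 0" and le: "\<And>n. r ^ (2 ^ n) \<le> C * M ^ (2 ^ n)"
  shows "r \<le> M"
proof (rule ccontr)
  assume "\<not> r \<le> M"
  then have r: "r > M" by simp
  show False
  proof (cases "M = 0")
    case True
    then show False using le[of 0] r by simp
  next
    case False
    then have M: "M > 0" using assms by simp
    then have q: "r / M > 1" using r by simp
    then obtain k where "C < (r / M) ^ k" using real_arch_pow by blast
    also have "\<dots> \<le> (r / M) ^ (2 ^ k)"
      using q by (intro power_increasing) auto
    also have "\<dots> \<le> C"
      using le[of k] M by (simp add: power_divide field_simps)
    finally show False by simp
  qed
qed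

text \<open>For small \<open>c\<close> in the direction of \<open>- cnj w\<close> the linear term
  dominates the quadratic one. This is the vanishing of the first variation at a minimum in
  \<open>Riesz\<close>.\<close>

lemma complex_zero_if_variation_nonneg:
  fixes w :: complex and q :: real
  assumes "\<And>c. 2 * Re (c * w) + (cmod c)\<^sup>2 * q \<ge> 0" "q \<ge> 0"
  shows "w = 0"
proof (rule ccontr)
  assume w: "w \<noteq> 0"
  \<comment> \<open>At \<open>c = - t * cnj w\<close> the expression is
    \<open>t * (cmod w)\<^sup>2 * (t * q - 2)\<close>, so \<open>t * q \<le> 1\<close> suffices;
    \<open>q + 1\<close> also covers \<open>q = 0\<close>.\<close>
  define t where "t = 1 / (q + 1)"
  have t: "t > 0" "t * q \<le> 1" using assms(2) by (simp_all add: t_def)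
  have "2 * Re (complex_of_real (- t) * cnj w * w)
      + (cmod (complex_of_real (- t) * cnj w))\<^sup>2 * q \<ge> 0"
    by (rule assms(1))
  also have "complex_of_real (- t) * cnj w * w = complex_of_real (- t * (cmod w)\<^sup>2)"
    by (simp add: complex_norm_square mult.commute mult.assoc del: of_real_power)
  finally have "- 2 * t * (cmod w)\<^sup>2 + t\<^sup>2 * (cmod w)\<^sup>2 * q \<ge> 0"
    by (simp add: norm_mult power_mult_distrib)
  then have "t * (cmod w)\<^sup>2 * (t * q - 2) \<ge> 0"
    by (simp add: algebra_simps power2_eq_square)
  moreover have "t * (cmod w)\<^sup>2 > 0" using t w by simp
  ultimately show False using t by (simp add: zero_le_mult_iff)
qed

section \<open>The seminorm of a state\<close>

locale gns_state =
  fixes \<phi> :: "'a::cstar_algebra_1 \<Rightarrow>\<^sub>L complex"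
  assumes is_state: "is_state \<phi>"
begin

lemmas phi_add = blinfun.add_right[of \<phi>]
lemmas phi_diff = blinfun.diff_right[of \<phi>]
lemmas phi_minus = blinfun.minus_right[of \<phi>]

lemma phi_scaleC: "blinfun_apply \<phi> (c *\<^sub>C a) = c * blinfun_apply \<phi> a"
  using is_state by (simp add: is_state_def)

lemma phi_one: "blinfun_apply \<phi> 1 = 1"
  using is_state by (simp add: is_state_def)

lemma phi_pos: "blinfun_apply \<phi> (star a * a) \<in> \<real>\<^sub>\<ge>\<^sub>0"
  using is_state by (simp add: is_state_def)

text \<open>Positivity at \<open>a + c *\<^sub>C 1\<close> forces the cross term to be real for
  every \<open>c\<close>. Then \<open>c = 1\<close> compares the imaginary parts and
  \<open>c = \<i>\<close> the real parts.\<close>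

lemma phi_star: "blinfun_apply \<phi> (star a) = cnj (blinfun_apply \<phi> a)"
proof -
  let ?p = "blinfun_apply \<phi>"
  have *: "Im (c * ?p (star a) + cnj c * ?p a) = 0" for c
  proof -
    have "?p (star (a + c *\<^sub>C 1) * (a + c *\<^sub>C 1))
        = ?p (star a * a) + (c * ?p (star a) + cnj c * ?p a) + c * cnj c"
      by (simp add: star_add star_scaleC star_one distrib_left distrib_right
        mult_scaleC_left mult_scaleC_right phi_add phi_scaleC phi_one scaleC_add_right)
    then show ?thesis
      using phi_pos[of "a + c *\<^sub>C 1"] phi_pos[of a]
      by (simp add: complex_nonneg_Reals_iff)
  qed
  from *[of 1] *[of \<i>] show ?thesis
    by (simp add: complex_eq_iff)
qed

lemma phi_star_mult_swap: "blinfun_apply \<phi> (star a * b) = cnj (blinfun_apply \<phi> (star b * a))"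
  using phi_star[of "star b * a"] by (simp add: star_mult star_star)

abbreviation sn :: "'a \<Rightarrow> real" where "sn \<equiv> gns_seminorm \<phi>"

lemma sn_nonneg: "sn a \<ge> 0"
  using phi_pos[of a] by (simp add: gns_seminorm_def complex_nonneg_Reals_iff)

lemma sn_square: "(sn a)\<^sup>2 = Re (blinfun_apply \<phi> (star a * a))"
  using phi_pos[of a] by (simp add: gns_seminorm_def complex_nonneg_Reals_iff)

lemma phi_star_mult_self: "blinfun_apply \<phi> (star a * a) = complex_of_real ((sn a)\<^sup>2)"
  using phi_pos[of a] by (simp add: sn_square complex_nonneg_Reals_iff complex_eq_iff)

lemma sn_scaleC: "sn (c *\<^sub>C a) = cmod c * sn a"
proof -
  have "(sn (c *\<^sub>C a))\<^sup>2 = (cmod c * sn a)\<^sup>2"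
    by (simp add: sn_square[of "c *\<^sub>C a"] star_scaleC mult_scaleC_left mult_scaleC_right
      phi_scaleC phi_star_mult_self power_mult_distrib flip: complex_norm_square mult.assoc)
  then show ?thesis
    by (simp add: sn_nonneg)
qed

lemma sn_minus: "sn (- a) = sn a"
  using sn_scaleC[of "-1" a] by (simp add: scaleC_minus_one)

lemma sn_minus_commute: "sn (a - b) = sn (b - a)"
  using sn_minus[of "a - b"] by simp

lemma sn_zero: "sn 0 = 0"
  using sn_scaleC[of 0 0] by (simp add: scaleC_zero_left)

lemma sn_add_square:
  "(sn (a + b))\<^sup>2 = (sn a)\<^sup>2 + 2 * Re (blinfun_apply \<phi> (star b * a)) + (sn b)\<^sup>2"
  using phi_star_mult_swap[of a b]
  by (simp add: sn_square star_add distrib_left distrib_right phi_add)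

lemma sn_add_scaleC_square:
  "(sn (a + c *\<^sub>C b))\<^sup>2 = (sn a)\<^sup>2 + 2 * Re (c * blinfun_apply \<phi> (star a * b)) + (cmod c)\<^sup>2 * (sn b)\<^sup>2"
proof -
  have "Re (blinfun_apply \<phi> (star (c *\<^sub>C b) * a)) = Re (blinfun_apply \<phi> (star a * c *\<^sub>C b))"
    by (subst phi_star_mult_swap) simp
  then show ?thesis
    by (simp add: sn_add_square sn_scaleC power_mult_distrib mult_scaleC_right phi_scaleC)
qed

lemma parallelogram: "(sn (a + b))\<^sup>2 + (sn (a - b))\<^sup>2 = 2 * (sn a)\<^sup>2 + 2 * (sn b)\<^sup>2"
  using sn_add_square[of a b] sn_add_square[of a "- b"]
  by (simp add: star_minus phi_minus sn_minus)

text \<open>With w the left-hand value, the choice \<open>c = - t * cnj w\<close> turns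
  nonnegativity of the square of \<open>sn (b + c *\<^sub>C a)\<close> into a quadratic inequality
  in a real \<open>t\<close>.\<close>

lemma Cauchy_Schwarz: "cmod (blinfun_apply \<phi> (star b * a)) \<le> sn b * sn a"
proof -
  let ?w = "blinfun_apply \<phi> (star b * a)"
  have pos: "0 \<le> (sn b)\<^sup>2 + 2 * Re (c * ?w) + (cmod c)\<^sup>2 * (sn a)\<^sup>2" for c
    using sn_add_scaleC_square[of b c a] by (metis zero_le_power2)
  define q where "q = (sn a)\<^sup>2"
  have "(cmod ?w)\<^sup>2 \<le> (sn b)\<^sup>2 * q"
  proof -
    have t: "0 \<le> (sn b)\<^sup>2 - 2 * t * (cmod ?w)\<^sup>2 + t\<^sup>2 * (cmod ?w)\<^sup>2 * q" for t :: real
    proof -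
      have "complex_of_real (- t) * cnj ?w * ?w = complex_of_real (- t * (cmod ?w)\<^sup>2)"
        by (simp add: complex_norm_square mult.commute mult.assoc del: of_real_power)
      with pos[of "complex_of_real (- t) * cnj ?w"] show ?thesis
        unfolding q_def by (simp only: norm_mult power_mult_distrib norm_of_real
            complex_mod_cnj Re_complex_of_real power2_abs) simp
    qed
    show ?thesis
    proof (cases "q = 0")
      case True
      have "(cmod ?w)\<^sup>2 = 0"
      proof (rule ccontr)
        assume "(cmod ?w)\<^sup>2 \<noteq> 0"
        then show False
          \<comment> \<open>For \<open>q = 0\<close> the inequality is affine in \<open>t\<close>;
            at this \<open>t\<close> its right side is \<open>- (sn b)\<^sup>2 - 2\<close>.\<close>
          using t[of "((sn b)\<^sup>2 + 1) / (cmod ?w)\<^sup>2"] True zero_le_power2[of "sn b"]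
          by (simp del: zero_le_power2)
      qed
      then show ?thesis using True by simp
    next
      case False
      then have "q > 0" by (simp add: q_def)
      then show ?thesis
        \<comment> \<open>This is the minimiser of the quadratic when \<open>cmod ?w\<close> is
          nonzero.\<close>
        using t[of "1 / q"] by (simp add: power2_eq_square field_simps)
    qed
  qed
  then have "(cmod ?w)\<^sup>2 \<le> (sn b * sn a)\<^sup>2"
    by (simp add: q_def power_mult_distrib)
  then show ?thesis
    by (rule power2_le_imp_le) (simp add: sn_nonneg)
qed

lemma sn_triangle: "sn (a + b) \<le> sn a + sn b"
proof -
  have "Re (blinfun_apply \<phi> (star b * a)) \<le> sn b * sn a"
    using Cauchy_Schwarz[of b a] complex_Re_le_cmod order_trans by blast
  then have "(sn (a + b))\<^sup>2 \<le> (sn a + sn b)\<^sup>2"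
    by (simp add: sn_add_square power2_sum mult.commute)
  then show ?thesis
    by (rule power2_le_imp_le) (simp add: sn_nonneg)
qed

lemma sn_triangle_diff: "sn (a - c) \<le> sn (a - b) + sn (b - c)"
  using sn_triangle[of "a - b" "b - c"] by simp

text \<open>Iterating the Cauchy-Schwarz inequality on \<open>\<phi>(b\<^sup>* (a\<^sup>*a)\<^bsup>2^n\<^esup> b)\<close> and using
  boundedness of \<open>\<phi>\<close> replaces the positivity of \<open>\<parallel>a\<parallel>\<^sup>2 - a\<^sup>*a\<close>, so that no functional
  calculus is needed.\<close>

lemma sn_mult_le: "sn (a * b) \<le> norm a * sn b"
proof -
  define P where "P = star a * a"
  have starP: "star (P ^ k) = P ^ k" for k
    by (simp add: star_power P_def star_mult star_star)
  define p where "p = (sn b)\<^sup>2"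
  define q where "q n = Re (blinfun_apply \<phi> (star b * (P ^ (2 ^ n) * b)))" for n :: nat
  \<comment> \<open>Powers of \<open>P\<close> are self-adjoint, so the square of the seminorm of
    \<open>P ^ (2 ^ n) * b\<close> contains \<open>P\<close> with twice the exponent. Cauchy-Schwarz
    for \<open>b\<close> and this element is one doubling step.\<close>
  have step: "(q n)\<^sup>2 \<le> p * q (Suc n)" for n
  proof -
    let ?y = "P ^ (2 ^ n) * b"
    have "star ?y * ?y = star b * (P ^ (2 ^ Suc n) * b)"
      by (simp add: star_mult starP mult.assoc power_add mult_2 flip: power_add)
        (simp add: power_add mult.assoc)
    then have y: "(sn ?y)\<^sup>2 = q (Suc n)"
      by (simp add: sn_square q_def)
    have "\<bar>q n\<bar> \<le> sn b * sn ?y"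
      unfolding q_def using Cauchy_Schwarz[of b ?y] abs_Re_le_cmod order_trans by blast
    then have "\<bar>q n\<bar>\<^sup>2 \<le> (sn b * sn ?y)\<^sup>2" by (rule power_mono) simp
    then show ?thesis by (simp add: power_mult_distrib y p_def)
  qed
  define C where "C = norm \<phi> * (norm (star b) * norm b)"
  have bound: "q n \<le> C * norm P ^ (2 ^ n)" for n
  proof -
    have "q n \<le> cmod (blinfun_apply \<phi> (star b * (P ^ (2 ^ n) * b)))"
      unfolding q_def by (rule complex_Re_le_cmod)
    also have "\<dots> \<le> norm \<phi> * norm (star b * (P ^ (2 ^ n) * b))"
      by (rule norm_blinfun)
    also have "\<dots> \<le> norm \<phi> * (norm (star b) * (norm P ^ (2 ^ n) * norm b))"
      by (intro norm_mult_ineq[THEN order_trans] mult_left_mono mult_right_mono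
          norm_power_ineq norm_ge_zero)
    finally show ?thesis by (simp add: C_def ac_simps)
  qed
  have q0: "q 0 = (sn (a * b))\<^sup>2"
    by (simp add: q_def P_def sn_square star_mult mult.assoc)
  have "q 0 \<le> p * norm P"
  proof (cases "p = 0")
    case True
    then show ?thesis using step[of 0] by simp
  next
    case False
    then have p: "p > 0" by (simp add: p_def)
    \<comment> \<open>Dividing \<open>step\<close> by \<open>p\<^sup>2\<close> makes
      \<open>q n / p\<close> at least the square of its predecessor in absolute terms; the left side
      stays nonnegative because \<open>q 0\<close> is a square.\<close>
    have "(q 0 / p) ^ (2 ^ n) \<le> q n / p" for n
    proof (induction n)
      case (Suc n)
      have "(q 0 / p) ^ (2 ^ Suc n) = ((q 0 / p) ^ (2 ^ n))\<^sup>2"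
        by (simp add: power_mult[symmetric] mult.commute)
      also have "\<dots> \<le> (q n / p)\<^sup>2"
        using Suc p q0 by (intro power_mono) simp_all
      also have "\<dots> \<le> q (Suc n) / p"
        using step[of n] p by (simp add: power2_eq_square field_simps)
      finally show ?case .
    qed simp
    also have "q n / p \<le> C / p * norm P ^ (2 ^ n)" for n
      using bound[of n] p by (simp add: field_simps)
    finally have "q 0 / p \<le> norm P"
      by (rule le_if_power_two_power_le[rotated]) simp
    then show ?thesis using p by (simp add: field_simps)
  qed
  then have "(sn (a * b))\<^sup>2 \<le> (norm a * sn b)\<^sup>2"
    by (simp add: q0 p_def P_def norm_star_mult_self power_mult_distrib mult.commute)
  then show ?thesis
    by (rule power2_le_imp_le) (simp add: sn_nonneg)
qed

section \<open>The inner product space \<open>L\<^sup>2(A, \<phi>)\<close>\<close>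

abbreviation Cau :: "(nat \<Rightarrow> 'a) set" where "Cau \<equiv> gns_Cauchy \<phi>"

lemma CauchyD:
  assumes "x \<in> Cau" "e > 0"
  obtains N where "\<And>m n. m \<ge> N \<Longrightarrow> n \<ge> N \<Longrightarrow> sn (x m - x n) < e"
  using assms unfolding gns_Cauchy_def by blast

lemma CauchyI:
  assumes "\<And>e. e > 0 \<Longrightarrow> \<exists>N. \<forall>m\<ge>N. \<forall>n\<ge>N. sn (x m - x n) < e"
  shows "x \<in> Cau"
  using assms unfolding gns_Cauchy_def by blast

lemma Cauchy_const: "(\<lambda>_. a) \<in> Cau"
  by (rule CauchyI) (simp add: sn_zero)

lemma Cauchy_add:
  assumes "x \<in> Cau" "y \<in> Cau"
  shows "(\<lambda>n. x n + y n) \<in> Cau"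
proof (rule CauchyI)
  fix e :: real assume "e > 0"
  then have e: "e / 2 > 0" by simp
  obtain N where N: "\<And>m n. m \<ge> N \<Longrightarrow> n \<ge> N \<Longrightarrow> sn (x m - x n) < e / 2"
    using CauchyD[OF assms(1) e] by blast
  obtain M where M: "\<And>m n. m \<ge> M \<Longrightarrow> n \<ge> M \<Longrightarrow> sn (y m - y n) < e / 2"
    using CauchyD[OF assms(2) e] by blast
  have "sn (x m + y m - (x n + y n)) < e" if "m \<ge> max N M" "n \<ge> max N M" for m n
    using that sn_triangle[of "x m - x n" "y m - y n"] N[of m n] M[of m n]
    by (simp add: algebra_simps)
  then show "\<exists>N. \<forall>m\<ge>N. \<forall>n\<ge>N. sn (x m + y m - (x n + y n)) < e" by blast
qed

lemma Cauchy_lift: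
  assumes "x \<in> Cau" and diff: "\<And>a b. f (a - b) = f a - f b" and K: "\<And>a. sn (f a) \<le> K * sn a"
  shows "(\<lambda>n. f (x n)) \<in> Cau"
proof (rule CauchyI)
  fix e :: real assume "e > 0"
  \<comment> \<open>\<open>\<bar>K\<bar> + 1\<close> is positive for every real \<open>K\<close>, so
    it can be divided by.\<close>
  then have e: "e / (\<bar>K\<bar> + 1) > 0" by simp
  obtain N where N: "\<And>m n. m \<ge> N \<Longrightarrow> n \<ge> N \<Longrightarrow> sn (x m - x n) < e / (\<bar>K\<bar> + 1)"
    using CauchyD[OF assms(1) e] by blast
  have "sn (f (x m) - f (x n)) < e" if "m \<ge> N" "n \<ge> N" for m n
  proof -
    have "sn (f (x m) - f (x n)) \<le> K * sn (x m - x n)"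
      using K[of "x m - x n"] by (simp add: diff)
    also have "\<dots> \<le> (\<bar>K\<bar> + 1) * sn (x m - x n)"
      by (intro mult_right_mono) (simp_all add: sn_nonneg)
    also have "\<dots> < e" using N[OF that] by (simp add: field_simps)
    finally show ?thesis .
  qed
  then show "\<exists>N. \<forall>m\<ge>N. \<forall>n\<ge>N. sn (f (x m) - f (x n)) < e" by blast
qed

lemma Cauchy_scaleC: "x \<in> Cau \<Longrightarrow> (\<lambda>n. c *\<^sub>C x n) \<in> Cau"
  by (rule Cauchy_lift[where K = "cmod c"]) (simp_all add: sn_scaleC scaleC_diff_right)

lemma Cauchy_minus: "x \<in> Cau \<Longrightarrow> (\<lambda>n. - x n) \<in> Cau"
  using Cauchy_scaleC[of x "-1"] by (simp add: scaleC_minus_one)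

lemma Cauchy_diff: "x \<in> Cau \<Longrightarrow> y \<in> Cau \<Longrightarrow> (\<lambda>n. x n - y n) \<in> Cau"
  using Cauchy_add[of x "\<lambda>n. - y n"] by (simp add: Cauchy_minus)

lemma sn_diff_abs_le: "\<bar>sn a - sn b\<bar> \<le> sn (a - b)"
  using sn_triangle[of "a - b" b] sn_triangle[of "b - a" a] sn_minus_commute[of a b] by simp

lemma Cauchy_sn_convergent:
  assumes "x \<in> Cau"
  shows "convergent (\<lambda>n. sn (x n))"
  unfolding Cauchy_convergent_iff[symmetric]
proof (rule metric_CauchyI)
  fix e :: real assume "e > 0"
  then obtain N where N: "\<And>m n. m \<ge> N \<Longrightarrow> n \<ge> N \<Longrightarrow> sn (x m - x n) < e"
    using CauchyD[OF assms] by blast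
  show "\<exists>M. \<forall>m\<ge>M. \<forall>n\<ge>M. dist (sn (x m)) (sn (x n)) < e"
    using N by (intro exI[of _ N]) (auto simp: dist_real_def intro: le_less_trans[OF sn_diff_abs_le])
qed

lemma Cauchy_sn_bounded:
  assumes "x \<in> Cau"
  obtains B where "B > 0" "\<And>n. sn (x n) \<le> B"
proof -
  have "Bseq (\<lambda>n. sn (x n))"
    using Cauchy_sn_convergent[OF assms] by (rule convergent_imp_Bseq)
  then obtain B where "B > 0" "\<And>n. norm (sn (x n)) \<le> B" by (auto elim: BseqE)
  then show ?thesis using that[of B] by (auto simp: sn_nonneg)
qed

text \<open>Telescoping through \<open>star y' * x\<close>. It yields both convergence of the form
  along Cauchy sequences and its independence of representatives.\<close>

lemma phi_star_mult_diff_le: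
  "cmod (blinfun_apply \<phi> (star y * x) - blinfun_apply \<phi> (star y' * x'))
    \<le> sn (y - y') * sn x + sn y' * sn (x - x')"
proof -
  have "star y * x - star y' * x' = star (y - y') * x + star y' * (x - x')"
    by (simp add: star_diff algebra_simps)
  then have "blinfun_apply \<phi> (star y * x) - blinfun_apply \<phi> (star y' * x')
      = blinfun_apply \<phi> (star (y - y') * x) + blinfun_apply \<phi> (star y' * (x - x'))"
    by (metis phi_diff phi_add)
  then show ?thesis
    using norm_triangle_ineq[of "blinfun_apply \<phi> (star (y - y') * x)" "blinfun_apply \<phi> (star y' * (x - x'))"]
      Cauchy_Schwarz[of "y - y'" x] Cauchy_Schwarz[of y' "x - x'"] by simp
qed

lemma Cauchy_phi_convergent:
  assumes x: "x \<in> Cau" and y: "y \<in> Cau"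
  shows "convergent (\<lambda>n. blinfun_apply \<phi> (star (y n) * x n))"
  unfolding Cauchy_convergent_iff[symmetric]
proof (rule metric_CauchyI)
  fix e :: real assume e: "e > 0"
  obtain B where B: "B > 0" "\<And>n. sn (x n) \<le> B" using Cauchy_sn_bounded[OF x] by blast
  obtain C where C: "C > 0" "\<And>n. sn (y n) \<le> C" using Cauchy_sn_bounded[OF y] by blast
  have e2: "e / (2 * B) > 0" "e / (2 * C) > 0" using e B C by simp_all
  obtain N where N: "\<And>m n. m \<ge> N \<Longrightarrow> n \<ge> N \<Longrightarrow> sn (y m - y n) < e / (2 * B)"
    using CauchyD[OF y e2(1)] by blast
  obtain M where M: "\<And>m n. m \<ge> M \<Longrightarrow> n \<ge> M \<Longrightarrow> sn (x m - x n) < e / (2 * C)"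
    using CauchyD[OF x e2(2)] by blast
  have "dist (blinfun_apply \<phi> (star (y m) * x m)) (blinfun_apply \<phi> (star (y n) * x n)) < e"
    if "m \<ge> max M N" "n \<ge> max M N" for m n
  proof -
    have "sn (y m - y n) * sn (x m) \<le> sn (y m - y n) * B"
      using B sn_nonneg by (intro mult_left_mono) auto
    moreover have "sn (y n) * sn (x m - x n) \<le> C * sn (x m - x n)"
      using C sn_nonneg by (intro mult_right_mono) auto
    moreover have "sn (y m - y n) * B < e / 2" "C * sn (x m - x n) < e / 2"
      using N[of m n] M[of m n] that B(1) C(1) by (simp_all add: field_simps)
    ultimately show ?thesis
      using phi_star_mult_diff_le[of "y m" "x m" "y n" "x n"] by (simp add: dist_norm)
  qed
  then show "\<exists>M. \<forall>m\<ge>M. \<forall>n\<ge>M. dist (blinfun_apply \<phi> (star (y m) * x m))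
      (blinfun_apply \<phi> (star (y n) * x n)) < e" by blast
qed

section \<open>Classes of Cauchy sequences and the operations on them\<close>

lemma equiv_rel: "equiv Cau (gns_rel \<phi>)"
proof (rule equivI)
  show "gns_rel \<phi> \<subseteq> Cau \<times> Cau" by (auto simp: gns_rel_def)
  show "refl_on Cau (gns_rel \<phi>)" by (auto simp: refl_on_def gns_rel_def sn_zero)
  show "sym (gns_rel \<phi>)"
    by (rule symI) (auto simp: gns_rel_def sn_minus_commute)
  show "trans (gns_rel \<phi>)"
  proof (rule transI)
    fix x y z assume xy: "(x, y) \<in> gns_rel \<phi>" and yz: "(y, z) \<in> gns_rel \<phi>"
    then have "(\<lambda>n. sn (x n - y n) + sn (y n - z n)) \<longlonglongrightarrow> 0"
      using tendsto_add[of "\<lambda>n. sn (x n - y n)" 0 _ "\<lambda>n. sn (y n - z n)" 0]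
      by (simp add: gns_rel_def)
    then have "(\<lambda>n. sn (x n - z n)) \<longlonglongrightarrow> 0"
      by (rule tendsto_sandwich[OF _ _ tendsto_const, rotated 2])
        (auto simp: sn_nonneg sn_triangle_diff)
    then show "(x, z) \<in> gns_rel \<phi>" using xy yz by (simp add: gns_rel_def)
  qed
qed

definition cls :: "(nat \<Rightarrow> 'a) \<Rightarrow> (nat \<Rightarrow> 'a) set" where
  "cls x = gns_rel \<phi> `` {x}"

abbreviation E where "E \<equiv> carrier (L2 \<phi>)"
abbreviation ip where "ip \<equiv> vinner (L2 \<phi>)"
abbreviation nm where "nm \<equiv> vnorm (L2 \<phi>)"
abbreviation hat where "hat \<equiv> gns_hat \<phi>"
abbreviation add2 (infixl \<open>\<oplus>\<^sub>2\<close> 65) where "add2 \<equiv> vadd (L2 \<phi>)"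
abbreviation scale2 (infixr \<open>\<odot>\<^sub>2\<close> 75) where "scale2 \<equiv> vscale (L2 \<phi>)"

lemma hat_cls: "hat a = cls (\<lambda>_. a)"
  by (simp add: cls_def gns_hat_def)

lemma cls_eq_iff:
  "x \<in> Cau \<Longrightarrow> y \<in> Cau \<Longrightarrow> cls x = cls y \<longleftrightarrow> (\<lambda>n. sn (x n - y n)) \<longlonglongrightarrow> 0"
  using eq_equiv_class_iff[OF equiv_rel, of x y] by (simp add: cls_def gns_rel_def)

lemma cls_in: "x \<in> Cau \<Longrightarrow> cls x \<in> E"
  by (simp add: L2_def cls_def quotientI)

lemma hat_in: "hat a \<in> E"
  by (simp add: hat_cls cls_in Cauchy_const)

lemma E_cases:
  assumes "\<xi> \<in> E"
  obtains x where "x \<in> Cau" "\<xi> = cls x"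
  using assms by (auto simp: L2_def cls_def elim: quotientE)

text \<open>\<open>vadd\<close> is a union over all pairs of representatives; by congruence all
  members of the union are the same class, so any pair computes it.\<close>

lemma add_cls:
  assumes "x \<in> Cau" "y \<in> Cau"
  shows "cls x \<oplus>\<^sub>2 cls y = cls (\<lambda>n. x n + y n)"
proof -
  have "congruent2 (gns_rel \<phi>) (gns_rel \<phi>) (\<lambda>x y. cls (\<lambda>n. x n + y n))"
  proof (rule congruent2I')
    fix x x' y y' assume x: "(x, x') \<in> gns_rel \<phi>" and y: "(y, y') \<in> gns_rel \<phi>"
    then have "(\<lambda>n. sn (x n - x' n) + sn (y n - y' n)) \<longlonglongrightarrow> 0"
      using tendsto_add[of "\<lambda>n. sn (x n - x' n)" 0 _ "\<lambda>n. sn (y n - y' n)" 0]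
      by (simp add: gns_rel_def)
    then have "(\<lambda>n. sn (x n + y n - (x' n + y' n))) \<longlonglongrightarrow> 0"
      by (rule tendsto_sandwich[OF _ _ tendsto_const, rotated 2])
        (auto simp: sn_nonneg add_diff_add sn_triangle)
    then show "cls (\<lambda>n. x n + y n) = cls (\<lambda>n. x' n + y' n)"
      using x y by (simp add: cls_eq_iff Cauchy_add gns_rel_def)
  qed
  from UN_equiv_class2[OF equiv_rel equiv_rel this assms] show ?thesis
    by (simp add: L2_def cls_def)
qed

lemma cls_lift_cong:
  assumes "(x, y) \<in> gns_rel \<phi>"
    and diff: "\<And>a b. f (a - b) = f a - f b" and K: "\<And>a. sn (f a) \<le> K * sn a"
  shows "cls (\<lambda>n. f (x n)) = cls (\<lambda>n. f (y n))"
proof -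
  have xy: "x \<in> Cau" "y \<in> Cau" "(\<lambda>n. sn (x n - y n)) \<longlonglongrightarrow> 0"
    using assms(1) by (auto simp: gns_rel_def)
  have "(\<lambda>n. K * sn (x n - y n)) \<longlonglongrightarrow> 0"
    using tendsto_mult_left[OF xy(3), of K] by simp
  then have "(\<lambda>n. sn (f (x n) - f (y n))) \<longlonglongrightarrow> 0"
    by (rule tendsto_sandwich[OF _ _ tendsto_const, rotated 2])
      (auto simp: sn_nonneg K simp flip: diff)
  then show ?thesis
    using xy by (simp add: cls_eq_iff Cauchy_lift[OF _ diff K])
qed

lemma scale_cls:
  assumes "x \<in> Cau"
  shows "c \<odot>\<^sub>2 cls x = cls (\<lambda>n. c *\<^sub>C x n)"
proof -
  have "congruent (gns_rel \<phi>) (\<lambda>x. cls (\<lambda>n. c *\<^sub>C x n))"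
    by (rule congruentI, rule cls_lift_cong[where K = "cmod c"])
      (simp_all add: sn_scaleC scaleC_diff_right)
  from UN_equiv_class[OF equiv_rel this assms] show ?thesis
    by (simp add: L2_def cls_def)
qed

text \<open>\<open>vinner\<close> is a definite description ranging over all representatives, so it
  takes this value only once existence, independence of representatives and uniqueness of the limit
  are settled.\<close>

lemma ip_cls:
  assumes x: "x \<in> Cau" and y: "y \<in> Cau"
  shows "(\<lambda>n. blinfun_apply \<phi> (star (y n) * x n)) \<longlonglongrightarrow> ip (cls x) (cls y)"
proof -
  obtain z where z: "(\<lambda>n. blinfun_apply \<phi> (star (y n) * x n)) \<longlonglongrightarrow> z"
    using Cauchy_phi_convergent[OF x y] by (auto simp: convergent_def)
  have *: "(\<lambda>n. blinfun_apply \<phi> (star (y' n) * x' n)) \<longlonglongrightarrow> z"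
    if "x' \<in> cls x" "y' \<in> cls y" for x' y'
  proof -
    have x': "x' \<in> Cau" "(\<lambda>n. sn (x n - x' n)) \<longlonglongrightarrow> 0"
      and y': "y' \<in> Cau" "(\<lambda>n. sn (y n - y' n)) \<longlonglongrightarrow> 0"
      using that by (auto simp: cls_def gns_rel_def)
    obtain B where B: "\<And>n. sn (x n) \<le> B" by (rule Cauchy_sn_bounded[OF x]) blast
    obtain C where C: "\<And>n. sn (y' n) \<le> C" by (rule Cauchy_sn_bounded[OF y'(1)]) blast
    have "(\<lambda>n. blinfun_apply \<phi> (star (y n) * x n) - blinfun_apply \<phi> (star (y' n) * x' n)) \<longlonglongrightarrow> 0"
    proof (rule Lim_null_comparison)
      show "\<forall>\<^sub>F n in sequentially. norm (blinfun_apply \<phi> (star (y n) * x n)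
          - blinfun_apply \<phi> (star (y' n) * x' n)) \<le> sn (y n - y' n) * B + C * sn (x n - x' n)"
        using B C by (intro always_eventually allI order_trans[OF phi_star_mult_diff_le]
            add_mono mult_mono sn_nonneg order_refl) (auto intro: order_trans[OF sn_nonneg])
      show "(\<lambda>n. sn (y n - y' n) * B + C * sn (x n - x' n)) \<longlonglongrightarrow> 0"
        using tendsto_add[OF tendsto_mult_right[OF y'(2), of B] tendsto_mult_left[OF x'(2), of C]]
        by simp
    qed
    from tendsto_diff[OF z this] show ?thesis by simp
  qed
  have self: "x \<in> cls x" "y \<in> cls y"
    using x y by (auto simp: cls_def gns_rel_def sn_zero)
  have "(THE z. \<forall>x\<in>cls x. \<forall>y\<in>cls y. (\<lambda>n. blinfun_apply \<phi> (star (y n) * x n)) \<longlonglongrightarrow> z) = z"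
  proof (rule the_equality)
    show "\<forall>x\<in>cls x. \<forall>y\<in>cls y. (\<lambda>n. blinfun_apply \<phi> (star (y n) * x n)) \<longlonglongrightarrow> z"
      using * by blast
  next
    fix w assume "\<forall>x\<in>cls x. \<forall>y\<in>cls y. (\<lambda>n. blinfun_apply \<phi> (star (y n) * x n)) \<longlonglongrightarrow> w"
    then show "w = z" using self z LIMSEQ_unique by blast
  qed
  then show ?thesis using z by (simp add: L2_def)
qed

lemma ip_eqI:
  assumes "x \<in> Cau" "y \<in> Cau" "(\<lambda>n. blinfun_apply \<phi> (star (y n) * x n)) \<longlonglongrightarrow> z"
  shows "ip (cls x) (cls y) = z"
  using LIMSEQ_unique[OF ip_cls assms(3)] assms by blast

lemma ip_hat: "ip (hat a) (hat b) = blinfun_apply \<phi> (star b * a)"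
  unfolding hat_cls by (intro ip_eqI Cauchy_const tendsto_const)

lemma ip_cls_self:
  assumes "x \<in> Cau"
  shows "ip (cls x) (cls x) = complex_of_real ((nm (cls x))\<^sup>2)"
    and nm_cls: "(\<lambda>n. sn (x n)) \<longlonglongrightarrow> nm (cls x)"
proof -
  obtain r where r: "(\<lambda>n. sn (x n)) \<longlonglongrightarrow> r"
    using Cauchy_sn_convergent[OF assms] by (auto simp: convergent_def)
  then have r0: "r \<ge> 0" by (rule LIMSEQ_le_const) (simp add: sn_nonneg)
  have "ip (cls x) (cls x) = complex_of_real (r\<^sup>2)"
    by (rule ip_eqI[OF assms assms]) (simp only: phi_star_mult_self, intro tendsto_of_real tendsto_power r)
  then show "ip (cls x) (cls x) = complex_of_real ((nm (cls x))\<^sup>2)"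
    and "(\<lambda>n. sn (x n)) \<longlonglongrightarrow> nm (cls x)"
    using r r0 by (simp_all add: vnorm_def)
qed

lemma ip_self: "\<xi> \<in> E \<Longrightarrow> ip \<xi> \<xi> = complex_of_real ((nm \<xi>)\<^sup>2)"
  by (erule E_cases) (simp add: ip_cls_self)

lemma nm_nonneg:
  assumes "\<xi> \<in> E" shows "nm \<xi> \<ge> 0"
proof -
  obtain x where x: "x \<in> Cau" "\<xi> = cls x" by (rule E_cases[OF assms])
  show ?thesis unfolding x(2)
    by (rule LIMSEQ_le_const[OF nm_cls[OF x(1)]]) (simp add: sn_nonneg)
qed

lemma nm_hat: "nm (hat a) = sn a"
  using LIMSEQ_unique[OF nm_cls[OF Cauchy_const] tendsto_const, of a] by (simp add: hat_cls)

lemma add_in: "\<xi> \<in> E \<Longrightarrow> \<eta> \<in> E \<Longrightarrow> \<xi> \<oplus>\<^sub>2 \<eta> \<in> E"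
  by (elim E_cases) (simp add: add_cls cls_in Cauchy_add)

lemma scale_in: "\<xi> \<in> E \<Longrightarrow> c \<odot>\<^sub>2 \<xi> \<in> E"
  by (elim E_cases) (simp add: scale_cls cls_in Cauchy_scaleC)

lemma hat_add: "hat (a + b) = hat a \<oplus>\<^sub>2 hat b"
  by (simp add: hat_cls add_cls Cauchy_const)

lemma hat_scaleC: "hat (c *\<^sub>C a) = c \<odot>\<^sub>2 hat a"
  by (simp add: hat_cls scale_cls Cauchy_const)

lemma ip_swap:
  assumes "\<xi> \<in> E" "\<eta> \<in> E" shows "ip \<eta> \<xi> = cnj (ip \<xi> \<eta>)"
proof -
  obtain x where x: "x \<in> Cau" "\<xi> = cls x" by (rule E_cases[OF assms(1)])
  obtain y where y: "y \<in> Cau" "\<eta> = cls y" by (rule E_cases[OF assms(2)])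
  show ?thesis unfolding x y
    by (rule ip_eqI[OF y(1) x(1)])
      (subst phi_star_mult_swap, intro tendsto_cnj ip_cls x y)
qed

lemma ip_add_left:
  assumes "\<xi> \<in> E" "\<xi>' \<in> E" "\<eta> \<in> E" shows "ip (\<xi> \<oplus>\<^sub>2 \<xi>') \<eta> = ip \<xi> \<eta> + ip \<xi>' \<eta>"
proof -
  obtain x where x: "x \<in> Cau" "\<xi> = cls x" by (rule E_cases[OF assms(1)])
  obtain x' where x': "x' \<in> Cau" "\<xi>' = cls x'" by (rule E_cases[OF assms(2)])
  obtain y where y: "y \<in> Cau" "\<eta> = cls y" by (rule E_cases[OF assms(3)])
  show ?thesis
    unfolding x(2) x'(2) y(2) add_cls[OF x(1) x'(1)]
    using tendsto_add[OF ip_cls[OF x(1) y(1)] ip_cls[OF x'(1) y(1)]] x y x'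
    by (intro ip_eqI) (simp_all add: Cauchy_add distrib_left phi_add)
qed

lemma ip_scale_left:
  assumes "\<xi> \<in> E" "\<eta> \<in> E" shows "ip (c \<odot>\<^sub>2 \<xi>) \<eta> = c * ip \<xi> \<eta>"
proof -
  obtain x where x: "x \<in> Cau" "\<xi> = cls x" by (rule E_cases[OF assms(1)])
  obtain y where y: "y \<in> Cau" "\<eta> = cls y" by (rule E_cases[OF assms(2)])
  show ?thesis
    unfolding x(2) y(2) scale_cls[OF x(1)]
    using tendsto_mult_left[OF ip_cls[OF x(1) y(1)], of c] x y
    by (intro ip_eqI) (simp_all add: Cauchy_scaleC mult_scaleC_right phi_scaleC)
qed

lemma ip_add_right:
  "\<xi> \<in> E \<Longrightarrow> \<eta> \<in> E \<Longrightarrow> \<eta>' \<in> E \<Longrightarrow> ip \<xi> (\<eta> \<oplus>\<^sub>2 \<eta>') = ip \<xi> \<eta> + ip \<xi> \<eta>'"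
  by (simp add: ip_swap[of _ \<xi>] ip_add_left add_in)

lemma ip_scale_right:
  "\<xi> \<in> E \<Longrightarrow> \<eta> \<in> E \<Longrightarrow> ip \<xi> (c \<odot>\<^sub>2 \<eta>) = cnj c * ip \<xi> \<eta>"
  by (simp add: ip_swap[of _ \<xi>] ip_scale_left scale_in)

lemma L2_Cauchy_Schwarz:
  assumes "\<xi> \<in> E" "\<eta> \<in> E" shows "cmod (ip \<xi> \<eta>) \<le> nm \<xi> * nm \<eta>"
proof -
  obtain x where x: "x \<in> Cau" "\<xi> = cls x" by (rule E_cases[OF assms(1)])
  obtain y where y: "y \<in> Cau" "\<eta> = cls y" by (rule E_cases[OF assms(2)])
  show ?thesis unfolding x(2) y(2)
    using Cauchy_Schwarz[of "y _" "x _"]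
    by (intro LIMSEQ_le[OF tendsto_norm[OF ip_cls] tendsto_mult[OF nm_cls nm_cls]] x y)
      (simp add: mult.commute[of "sn (x _)"])
qed

lemma nm_triangle:
  assumes "\<xi> \<in> E" "\<eta> \<in> E" shows "nm (\<xi> \<oplus>\<^sub>2 \<eta>) \<le> nm \<xi> + nm \<eta>"
proof -
  obtain x where x: "x \<in> Cau" "\<xi> = cls x" by (rule E_cases[OF assms(1)])
  obtain y where y: "y \<in> Cau" "\<eta> = cls y" by (rule E_cases[OF assms(2)])
  show ?thesis unfolding x(2) y(2) add_cls[OF x(1) y(1)]
    by (intro LIMSEQ_le[OF nm_cls tendsto_add[OF nm_cls nm_cls]] x y Cauchy_add)
      (auto simp: sn_triangle)
qed

lemma nm_scale:
  assumes "\<xi> \<in> E" shows "nm (c \<odot>\<^sub>2 \<xi>) = cmod c * nm \<xi>"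
proof -
  obtain x where x: "x \<in> Cau" "\<xi> = cls x" by (rule E_cases[OF assms])
  show ?thesis unfolding x(2) scale_cls[OF x(1)]
    using LIMSEQ_unique[OF nm_cls[OF Cauchy_scaleC[OF x(1)]], of c]
      tendsto_mult_left[OF nm_cls[OF x(1)], of "cmod c"] by (simp add: sn_scaleC)
qed

text \<open>\<open>inner_space\<close> records no zero and no difference of vectors, hence the
  combination with -1 and a norm in place of an equation with 0.\<close>

lemma L2_diff_zero_imp_eq:
  assumes "\<xi> \<in> E" "\<eta> \<in> E" "nm (\<xi> \<oplus>\<^sub>2 (-1) \<odot>\<^sub>2 \<eta>) = 0" shows "\<xi> = \<eta>"
proof -
  obtain x where x: "x \<in> Cau" "\<xi> = cls x" by (rule E_cases[OF assms(1)])
  obtain y where y: "y \<in> Cau" "\<eta> = cls y" by (rule E_cases[OF assms(2)])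
  have "\<xi> \<oplus>\<^sub>2 (-1) \<odot>\<^sub>2 \<eta> = cls (\<lambda>n. x n - y n)"
    using x y by (simp add: scale_cls add_cls Cauchy_scaleC scaleC_minus_one Cauchy_minus)
  then show ?thesis
    using nm_cls[OF Cauchy_diff[OF x(1) y(1)]] assms(3) x y by (simp add: cls_eq_iff)
qed

section \<open>Density of the image of A\<close>

text \<open>\<open>E\<close> carries no topology, so convergence of \<open>hat (x n)\<close> to
  \<open>cls x\<close> is expressed through additive bounded \<open>f\<close>. The difference is the
  class of \<open>\<lambda>m. x m - x n\<close>, whose norm the Cauchy condition controls.\<close>

lemma hat_dense:
  assumes x: "x \<in> Cau"
    and add: "\<And>\<xi> \<eta>. \<xi> \<in> E \<Longrightarrow> \<eta> \<in> E \<Longrightarrow> f (\<xi> \<oplus>\<^sub>2 \<eta>) = f \<xi> + f \<eta>"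
    and bd: "\<And>\<xi>. \<xi> \<in> E \<Longrightarrow> cmod (f \<xi>) \<le> K * nm \<xi>"
  shows "(\<lambda>n. f (hat (x n))) \<longlonglongrightarrow> f (cls x)"
proof -
  have "(\<lambda>n. f (cls x) - f (hat (x n))) \<longlonglongrightarrow> 0"
  proof (rule LIMSEQ_I)
    fix r :: real assume "r > 0"
    \<comment> \<open>Passing to the limit keeps only a weak inequality; the factor 2 restores the
      strict one.\<close>
    then have e: "r / (\<bar>K\<bar> + 1) / 2 > 0" by simp
    obtain N where N: "\<And>m n. m \<ge> N \<Longrightarrow> n \<ge> N \<Longrightarrow> sn (x m - x n) < r / (\<bar>K\<bar> + 1) / 2"
      using CauchyD[OF x e] by blast
    have "norm (f (cls x) - f (hat (x n)) - 0) < r" if "n \<ge> N" for n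
    proof -
      define \<delta> where "\<delta> = cls (\<lambda>m. x m - x n)"
      have C: "(\<lambda>m. x m - x n) \<in> Cau" by (intro Cauchy_diff x Cauchy_const)
      then have \<delta>: "\<delta> \<in> E" by (simp add: \<delta>_def cls_in)
      have "cls x = \<delta> \<oplus>\<^sub>2 hat (x n)"
        using C by (simp add: \<delta>_def hat_cls add_cls Cauchy_const)
      then have "f (cls x) - f (hat (x n)) = f \<delta>" by (simp add: add \<delta> hat_in)
      moreover have "nm \<delta> \<le> r / (\<bar>K\<bar> + 1) / 2"
        unfolding \<delta>_def
        by (rule LIMSEQ_le_const2[OF nm_cls[OF C]]) (use N that in \<open>auto intro!: exI[of _ N] less_imp_le\<close>)
      then have "(\<bar>K\<bar> + 1) * nm \<delta> \<le> r / 2" by (simp add: field_simps)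
      moreover have "K * nm \<delta> \<le> (\<bar>K\<bar> + 1) * nm \<delta>"
        by (intro mult_right_mono nm_nonneg \<delta>) simp
      ultimately show ?thesis using bd[OF \<delta>] \<open>r > 0\<close> by simp
    qed
    then show "\<exists>N. \<forall>n\<ge>N. norm (f (cls x) - f (hat (x n)) - 0) < r" by blast
  qed
  from tendsto_diff[OF tendsto_const[of "f (cls x)"] this] show ?thesis by simp
qed

lemma eq_on_hat_imp_eq:
  assumes "\<xi> \<in> E"
    and "\<And>\<xi> \<eta>. \<xi> \<in> E \<Longrightarrow> \<eta> \<in> E \<Longrightarrow> f (\<xi> \<oplus>\<^sub>2 \<eta>) = f \<xi> + f \<eta>"
    and "\<And>\<xi>. \<xi> \<in> E \<Longrightarrow> cmod (f \<xi>) \<le> K * nm \<xi>"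
    and "\<And>\<xi> \<eta>. \<xi> \<in> E \<Longrightarrow> \<eta> \<in> E \<Longrightarrow> g (\<xi> \<oplus>\<^sub>2 \<eta>) = g \<xi> + g \<eta>"
    and "\<And>\<xi>. \<xi> \<in> E \<Longrightarrow> cmod (g \<xi>) \<le> L * nm \<xi>"
    and "\<And>a. f (hat a) = g (hat a)"
  shows "f \<xi> = g \<xi>"
proof -
  obtain x where x: "x \<in> Cau" "\<xi> = cls x" by (rule E_cases[OF assms(1)])
  have "(\<lambda>n. f (hat (x n))) \<longlonglongrightarrow> f (cls x)"
    by (rule hat_dense[OF x(1) assms(2,3)])
  moreover have "(\<lambda>n. g (hat (x n))) \<longlonglongrightarrow> g (cls x)"
    by (rule hat_dense[OF x(1) assms(4,5)])
  ultimately show ?thesis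
    using assms(6) x(2) by (simp add: LIMSEQ_unique)
qed

lemma L2_eqI_ip:
  assumes \<xi>: "\<xi> \<in> E" and \<eta>: "\<eta> \<in> E" and eq: "\<And>\<zeta>. \<zeta> \<in> E \<Longrightarrow> ip \<xi> \<zeta> = ip \<eta> \<zeta>"
  shows "\<xi> = \<eta>"
proof (rule L2_diff_zero_imp_eq[OF \<xi> \<eta>])
  let ?d = "\<xi> \<oplus>\<^sub>2 (-1) \<odot>\<^sub>2 \<eta>"
  have d: "?d \<in> E" by (simp add: add_in scale_in \<xi> \<eta>)
  then have "ip ?d ?d = ip \<xi> ?d - ip \<eta> ?d"
    by (subst ip_add_left) (simp_all add: \<xi> \<eta> scale_in ip_scale_left)
  then show "nm ?d = 0" using eq[OF d] ip_self[OF d] by simp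
qed

lemma L2_eqI:
  assumes \<xi>: "\<xi> \<in> E" and \<eta>: "\<eta> \<in> E" and eq: "\<And>b. ip \<xi> (hat b) = ip \<eta> (hat b)"
  shows "\<xi> = \<eta>"
proof (rule L2_eqI_ip[OF \<xi> \<eta>])
  fix \<zeta> assume \<zeta>: "\<zeta> \<in> E"
  have "ip \<zeta> \<xi> = ip \<zeta> \<eta>"
  proof (rule eq_on_hat_imp_eq[where K = "nm \<xi>" and L = "nm \<eta>", OF \<zeta>])
    show "ip (hat a) \<xi> = ip (hat a) \<eta>" for a
      using eq[of a] by (simp add: ip_swap[of _ "hat a"] \<xi> \<eta> hat_in)
  qed (simp_all add: ip_add_left \<xi> \<eta> L2_Cauchy_Schwarz[THEN order_trans] mult.commute)
  then show "ip \<xi> \<zeta> = ip \<eta> \<zeta>" using \<xi> \<eta> \<zeta> by (simp add: ip_swap[of \<zeta>])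
qed

section \<open>Riesz representation and bounded operators\<close>

lemma L2_eqI_left:
  assumes "\<xi> \<in> E" "\<eta> \<in> E" "\<And>b. ip (hat b) \<xi> = ip (hat b) \<eta>"
  shows "\<xi> = \<eta>"
  using assms by (intro L2_eqI) (simp_all add: ip_swap[of "hat _"] hat_in)

lemma nm_le_of_square_le:
  assumes "\<xi> \<in> E" "(nm \<xi>)\<^sup>2 \<le> K * nm \<xi>" "K \<ge> 0"
  shows "nm \<xi> \<le> K"
proof (cases "nm \<xi> = 0")
  case False
  then have "nm \<xi> > 0" using nm_nonneg[OF assms(1)] by simp
  then show ?thesis using assms(2) by (simp add: power2_eq_square)
qed (simp add: assms)

text \<open>A minimising sequence of \<open>s(a)\<^sup>2 - 2 Re f(a)\<close>, \<open>s\<close> the seminorm, over the dense subspace \<open>A\<close> is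
  Cauchy by the parallelogram law, so it is itself the representing vector and completeness
  of \<open>L\<^sup>2(A, \<phi>)\<close> is not needed.\<close>

lemma Riesz:
  fixes f :: "'a \<Rightarrow> complex"
  assumes add: "\<And>a b. f (a + b) = f a + f b"
    and scale: "\<And>c a. f (c *\<^sub>C a) = c * f a"
    and bd: "\<And>a. cmod (f a) \<le> K * sn a"
  obtains \<zeta> where "\<zeta> \<in> E" "nm \<zeta> \<le> K" "\<And>a. ip (hat a) \<zeta> = f a"
proof -
  define J where "J a = (sn a)\<^sup>2 - 2 * Re (f a)" for a
  define d where "d = Inf (range J)"
  have "- (K\<^sup>2) \<le> J a" for a
  proof -
    have "Re (f a) \<le> K * sn a" using bd[of a] complex_Re_le_cmod order_trans by blast
    moreover have "0 \<le> (sn a - K)\<^sup>2" by simp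
    ultimately show ?thesis by (simp add: J_def power2_diff algebra_simps)
  qed
  then have bdd: "bdd_below (range J)" by (auto simp: bdd_below_def)
  then have d: "d \<le> J a" for a by (simp add: d_def cInf_lower)
  have "\<exists>a. J a < d + inverse (Suc n)" for n
    using cInf_lessD[of "range J" "d + inverse (Suc n)"] by (auto simp: d_def)
  then obtain x where x: "\<And>n. J (x n) < d + inverse (Suc n)" by metis
  \<comment> \<open>The parallelogram law, with \<open>d\<close> as lower bound for \<open>J\<close>
    at the midpoint of \<open>a\<close> and \<open>b\<close>: nearly minimal values of
    \<open>J\<close> force nearby points.\<close>
  have xx: "(sn (a - b))\<^sup>2 \<le> 2 * J a + 2 * J b - 4 * d" for a b
  proof -
    have "J ((1/2) *\<^sub>C (a + b)) = (sn (a + b))\<^sup>2 / 4 - Re (f a) - Re (f b)"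
      by (simp add: J_def sn_scaleC scale add power_mult_distrib power_divide) (simp add: add_divide_distrib)
    then show ?thesis
      using d[of "(1/2) *\<^sub>C (a + b)"] parallelogram[of a b] by (simp add: J_def)
  qed
  have C: "x \<in> Cau"
  proof (rule CauchyI)
    fix e :: real assume e: "e > 0"
    then obtain N where N: "inverse (Suc N) < e\<^sup>2 / 4"
      using reals_Archimedean[of "e\<^sup>2 / 4"] by auto
    have "sn (x m - x n) < e" if "m \<ge> N" "n \<ge> N" for m n
    proof -
      have "inverse (real (Suc m)) \<le> inverse (Suc N)" "inverse (real (Suc n)) \<le> inverse (Suc N)"
        using that by (auto intro!: le_imp_inverse_le)
      then have "(sn (x m - x n))\<^sup>2 < e\<^sup>2"
        using xx[of "x m" "x n"] x[of m] x[of n] N by linarith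
      then show ?thesis using e by (simp add: power_less_imp_less_base)
    qed
    then show "\<exists>N. \<forall>m\<ge>N. \<forall>n\<ge>N. sn (x m - x n) < e" by blast
  qed
  let ?\<zeta> = "cls x"
  have eq: "ip (hat a) ?\<zeta> = f a" for a
  proof -
    let ?w = "ip (hat a) ?\<zeta> - f a"
    have lim: "(\<lambda>n. blinfun_apply \<phi> (star (x n) * a)) \<longlonglongrightarrow> ip (hat a) ?\<zeta>"
      using ip_cls[OF Cauchy_const C] by (simp add: hat_cls)
    have "2 * Re (c * ?w) + (cmod c)\<^sup>2 * (sn a)\<^sup>2 \<ge> 0" for c
    proof -
      \<comment> \<open>\<open>x n\<close> is minimal up to \<open>inverse (Suc n)\<close>, so
        moving it by \<open>c *\<^sub>C a\<close> lowers \<open>J\<close> by no more than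
        that.\<close>
      have ge: "2 * Re (c * (blinfun_apply \<phi> (star (x n) * a) - f a)) + (cmod c)\<^sup>2 * (sn a)\<^sup>2
          + inverse (Suc n) \<ge> 0" for n
        using d[of "x n + c *\<^sub>C a"] x[of n]
        by (simp add: J_def sn_add_scaleC_square add scale algebra_simps)
      have "(\<lambda>n. 2 * Re (c * (blinfun_apply \<phi> (star (x n) * a) - f a)) + (cmod c)\<^sup>2 * (sn a)\<^sup>2
          + inverse (Suc n)) \<longlonglongrightarrow> 2 * Re (c * ?w) + (cmod c)\<^sup>2 * (sn a)\<^sup>2 + 0"
        by (intro tendsto_intros lim LIMSEQ_inverse_real_of_nat)
      then show ?thesis using ge by (intro LIMSEQ_le_const) auto
    qed
    then have "?w = 0" by (rule complex_zero_if_variation_nonneg) simp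
    then show ?thesis by simp
  qed
  have "K \<ge> 0"
    using order_trans[OF norm_ge_zero bd[of 1]] by (simp add: gns_seminorm_def star_one phi_one)
  \<comment> \<open>Evaluating \<open>f\<close> along the minimising sequence itself: its values
    tend to the squared norm of the representing vector, while \<open>bd\<close> bounds them by
    \<open>K\<close> times the seminorms.\<close>
  moreover have "(nm ?\<zeta>)\<^sup>2 \<le> K * nm ?\<zeta>"
  proof -
    note \<zeta> = cls_in[OF C]
    have "(\<lambda>n. ip (hat (x n)) ?\<zeta>) \<longlonglongrightarrow> ip ?\<zeta> ?\<zeta>"
      using L2_Cauchy_Schwarz[OF _ \<zeta>]
      by (intro hat_dense[OF C, of _ "nm ?\<zeta>"]) (simp_all add: ip_add_left \<zeta> mult.commute)
    then have "(\<lambda>n. f (x n)) \<longlonglongrightarrow> complex_of_real ((nm ?\<zeta>)\<^sup>2)"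
      by (simp only: eq ip_self[OF \<zeta>])
    from tendsto_norm[OF this] have "(\<lambda>n. cmod (f (x n))) \<longlonglongrightarrow> (nm ?\<zeta>)\<^sup>2"
      by (simp only: norm_of_real abs_power2)
    then show ?thesis
      by (rule LIMSEQ_le[OF _ tendsto_mult_left[OF nm_cls[OF C]]]) (use bd in blast)
  qed
  ultimately have "nm ?\<zeta> \<le> K" using nm_le_of_square_le cls_in[OF C] by blast
  then show ?thesis using that cls_in[OF C] eq by blast
qed

abbreviation Ops where "Ops \<equiv> bounded_ops (L2 \<phi>)"

lemma ops_in: "T \<in> Ops \<Longrightarrow> \<xi> \<in> E \<Longrightarrow> T \<xi> \<in> E"
  by (auto simp: bounded_ops_def)

lemma ops_add: "T \<in> Ops \<Longrightarrow> \<xi> \<in> E \<Longrightarrow> \<eta> \<in> E \<Longrightarrow> T (\<xi> \<oplus>\<^sub>2 \<eta>) = T \<xi> \<oplus>\<^sub>2 T \<eta>"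
  by (auto simp: bounded_ops_def)

lemma ops_scale: "T \<in> Ops \<Longrightarrow> \<xi> \<in> E \<Longrightarrow> T (c \<odot>\<^sub>2 \<xi>) = c \<odot>\<^sub>2 T \<xi>"
  by (auto simp: bounded_ops_def)

lemma ops_bound:
  assumes "T \<in> Ops"
  obtains K where "K \<ge> 0" "\<And>\<xi>. \<xi> \<in> E \<Longrightarrow> nm (T \<xi>) \<le> K * nm \<xi>"
proof -
  obtain K where K: "\<And>\<xi>. \<xi> \<in> E \<Longrightarrow> nm (T \<xi>) \<le> K * nm \<xi>"
    using assms unfolding bounded_ops_def by blast
  have "nm (T \<xi>) \<le> \<bar>K\<bar> * nm \<xi>" if "\<xi> \<in> E" for \<xi>
    using K[OF that] mult_right_mono[OF abs_ge_self nm_nonneg[OF that], of K] by linarith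
  then show ?thesis using that[of "\<bar>K\<bar>"] by simp
qed

lemma opsI:
  assumes "\<And>\<xi>. \<xi> \<in> E \<Longrightarrow> T \<xi> \<in> E"
    and "\<And>\<xi>. \<xi> \<notin> E \<Longrightarrow> T \<xi> = undefined"
    and "\<And>\<xi> \<eta>. \<xi> \<in> E \<Longrightarrow> \<eta> \<in> E \<Longrightarrow> T (\<xi> \<oplus>\<^sub>2 \<eta>) = T \<xi> \<oplus>\<^sub>2 T \<eta>"
    and "\<And>c \<xi>. \<xi> \<in> E \<Longrightarrow> T (c \<odot>\<^sub>2 \<xi>) = c \<odot>\<^sub>2 T \<xi>"
    and "\<And>\<xi>. \<xi> \<in> E \<Longrightarrow> nm (T \<xi>) \<le> K * nm \<xi>"
  shows "T \<in> Ops"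
  using assms unfolding bounded_ops_def by (auto intro!: PiE_I exI[of _ K])

lemma ops_eqI:
  assumes S: "S \<in> Ops" and T: "T \<in> Ops" and eq: "\<And>\<xi>. \<xi> \<in> E \<Longrightarrow> S \<xi> = T \<xi>"
  shows "S = T"
proof (rule PiE_ext[OF _ _ eq])
  show "S \<in> E \<rightarrow>\<^sub>E E" "T \<in> E \<rightarrow>\<^sub>E E"
    using S T by (simp_all only: bounded_ops_def mem_Collect_eq)
qed

text \<open>Uniqueness of a bounded extension from the dense image of A; the definite descriptions
  in \<open>gns_rep\<close> and \<open>gns_unitary\<close> rest on it.\<close>

lemma ops_eqI_on_hat:
  assumes S: "S \<in> Ops" and T: "T \<in> Ops" and eq: "\<And>a. S (hat a) = T (hat a)"
  shows "S = T"
proof (rule ops_eqI[OF S T])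
  fix \<xi> assume \<xi>: "\<xi> \<in> E"
  have bd: "cmod (ip (R \<xi>) \<eta>) \<le> (K * nm \<eta>) * nm \<xi>"
    if "R \<in> Ops" "\<And>\<xi>. \<xi> \<in> E \<Longrightarrow> nm (R \<xi>) \<le> K * nm \<xi>" "\<xi> \<in> E" "\<eta> \<in> E" for R K \<xi> \<eta>
    using L2_Cauchy_Schwarz[of "R \<xi>" \<eta>] mult_right_mono[OF that(2)[OF that(3)] nm_nonneg[OF that(4)]]
      that ops_in by (simp add: ac_simps)
  obtain K where K: "\<And>\<xi>. \<xi> \<in> E \<Longrightarrow> nm (S \<xi>) \<le> K * nm \<xi>" by (rule ops_bound[OF S]) blast
  obtain L where L: "\<And>\<xi>. \<xi> \<in> E \<Longrightarrow> nm (T \<xi>) \<le> L * nm \<xi>" by (rule ops_bound[OF T]) blast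
  show "S \<xi> = T \<xi>"
  proof (rule L2_eqI_ip)
    fix \<eta> assume \<eta>: "\<eta> \<in> E"
    show "ip (S \<xi>) \<eta> = ip (T \<xi>) \<eta>"
    proof (rule eq_on_hat_imp_eq[OF \<xi>, of "\<lambda>\<xi>. ip (S \<xi>) \<eta>" "K * nm \<eta>" "\<lambda>\<xi>. ip (T \<xi>) \<eta>" "L * nm \<eta>"])
      show "cmod (ip (S \<zeta>) \<eta>) \<le> K * nm \<eta> * nm \<zeta>" if "\<zeta> \<in> E" for \<zeta>
        by (rule bd[OF S K that \<eta>])
      show "cmod (ip (T \<zeta>) \<eta>) \<le> L * nm \<eta> * nm \<zeta>" if "\<zeta> \<in> E" for \<zeta>
        by (rule bd[OF T L that \<eta>])
    qed (simp_all add: S T \<eta> eq ops_add ops_in ip_add_left)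
  qed (simp_all add: S T \<xi> ops_in)
qed

text \<open>\<open>T\<close> is the adjoint of the map taking \<open>hat b\<close> to
  \<open>R b\<close>. Taking for \<open>R b\<close> the value of an operator at \<open>hat b\<close>
  gives operator adjoints; taking Riesz vectors of a dominated state gives its Radon-Nikodym
  derivative.\<close>

lemma ex_op_of_sesquilinear:
  assumes R: "\<And>b. R b \<in> E"
    and add: "\<And>a b. R (a + b) = R a \<oplus>\<^sub>2 R b"
    and scale: "\<And>c a. R (c *\<^sub>C a) = c \<odot>\<^sub>2 R a"
    and bd: "\<And>a. nm (R a) \<le> K * sn a"
  obtains T where "T \<in> Ops" "\<And>\<xi> b. \<xi> \<in> E \<Longrightarrow> ip (T \<xi>) (hat b) = ip \<xi> (R b)"
proof -
  \<comment> \<open>\<open>Riesz\<close> asks for linearity in \<open>b\<close>, so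
    \<open>R b\<close> is the first entry; conjugation afterwards gives the form in the
    conclusion.\<close>
  have "\<exists>\<zeta>. \<zeta> \<in> E \<and> nm \<zeta> \<le> K * nm \<xi> \<and> (\<forall>b. ip (hat b) \<zeta> = ip (R b) \<xi>)" if \<xi>: "\<xi> \<in> E" for \<xi>
  proof (rule Riesz[of "\<lambda>b. ip (R b) \<xi>" "K * nm \<xi>"])
    show "cmod (ip (R a) \<xi>) \<le> K * nm \<xi> * sn a" for a
      using L2_Cauchy_Schwarz[OF R[of a] \<xi>] mult_right_mono[OF bd[of a] nm_nonneg[OF \<xi>]]
      by (simp add: ac_simps)
  qed (use \<xi> in \<open>auto simp: add scale R ip_add_left ip_scale_left\<close>)
  then obtain t where t: "\<And>\<xi>. \<xi> \<in> E \<Longrightarrow> t \<xi> \<in> E" "\<And>\<xi>. \<xi> \<in> E \<Longrightarrow> nm (t \<xi>) \<le> K * nm \<xi>"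
    "\<And>\<xi> b. \<xi> \<in> E \<Longrightarrow> ip (hat b) (t \<xi>) = ip (R b) \<xi>"
    by metis
  have "restrict t E \<in> Ops"
  proof (rule opsI[where K = K])
    fix \<xi> \<eta> assume *: "\<xi> \<in> E" "\<eta> \<in> E"
    then have "t (\<xi> \<oplus>\<^sub>2 \<eta>) = t \<xi> \<oplus>\<^sub>2 t \<eta>"
      by (intro L2_eqI_left) (simp_all add: t add_in ip_add_right hat_in R)
    then show "restrict t E (\<xi> \<oplus>\<^sub>2 \<eta>) = restrict t E \<xi> \<oplus>\<^sub>2 restrict t E \<eta>"
      using * by (simp add: add_in)
  next
    fix c \<xi> assume *: "\<xi> \<in> E"
    then have "t (c \<odot>\<^sub>2 \<xi>) = c \<odot>\<^sub>2 t \<xi>"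
      by (intro L2_eqI_left) (simp_all add: t scale_in ip_scale_right hat_in R)
    then show "restrict t E (c \<odot>\<^sub>2 \<xi>) = c \<odot>\<^sub>2 restrict t E \<xi>"
      using * by (simp add: scale_in)
  qed (auto simp: t)
  moreover have "ip (restrict t E \<xi>) (hat b) = ip \<xi> (R b)" if "\<xi> \<in> E" for \<xi> b
    using that t by (simp add: ip_swap[of "hat b"] ip_swap[of "R b"] hat_in R)
  ultimately show ?thesis using that by blast
qed

text \<open>The description defining \<open>op_adjoint\<close> is met by the operator built from the
  vectors \<open>T (hat b)\<close>: the adjoint identity holds on \<open>hat\<close> vectors and
  extends by density.\<close>

lemma op_adjoint:
  assumes T: "T \<in> Ops"
  shows "op_adjoint (L2 \<phi>) T \<in> Ops"
    and "\<And>\<xi> \<eta>. \<xi> \<in> E \<Longrightarrow> \<eta> \<in> E \<Longrightarrow> ip (T \<xi>) \<eta> = ip \<xi> (op_adjoint (L2 \<phi>) T \<eta>)"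
proof -
  obtain K where K: "K \<ge> 0" "\<And>\<xi>. \<xi> \<in> E \<Longrightarrow> nm (T \<xi>) \<le> K * nm \<xi>" by (rule ops_bound[OF T]) blast
  obtain S where S: "S \<in> Ops" "\<And>\<xi> b. \<xi> \<in> E \<Longrightarrow> ip (S \<xi>) (hat b) = ip \<xi> (T (hat b))"
  proof (rule ex_op_of_sesquilinear[of "\<lambda>b. T (hat b)" K])
    show "nm (T (hat a)) \<le> K * sn a" for a
      using K(2)[OF hat_in, of a] by (simp add: nm_hat)
  qed (simp_all add: T ops_in hat_in hat_add hat_scaleC ops_add ops_scale)
  have *: "ip (T \<xi>) \<eta> = ip \<xi> (S \<eta>)" if \<xi>: "\<xi> \<in> E" and \<eta>: "\<eta> \<in> E" for \<xi> \<eta>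
  proof (rule eq_on_hat_imp_eq[OF \<xi>, of "\<lambda>\<xi>. ip (T \<xi>) \<eta>" "K * nm \<eta>" "\<lambda>\<xi>. ip \<xi> (S \<eta>)" "nm (S \<eta>)"])
    show "cmod (ip (T \<xi>) \<eta>) \<le> K * nm \<eta> * nm \<xi>" if "\<xi> \<in> E" for \<xi>
      using L2_Cauchy_Schwarz[OF ops_in[OF T that] \<eta>] mult_right_mono[OF K(2)[OF that] nm_nonneg[OF \<eta>]]
      by (simp add: ac_simps)
    show "cmod (ip \<xi> (S \<eta>)) \<le> nm (S \<eta>) * nm \<xi>" if "\<xi> \<in> E" for \<xi>
      using L2_Cauchy_Schwarz[OF that ops_in[OF S(1) \<eta>]] by (simp add: ac_simps)
    show "ip (T (hat a)) \<eta> = ip (hat a) (S \<eta>)" for a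
      using S(2)[OF \<eta>, of a] \<eta> S(1) T
      by (simp add: ip_swap[of _ "T (hat a)"] ip_swap[of _ "hat a"] ops_in hat_in flip: S(2)[OF \<eta>])
  qed (simp_all add: ip_add_left ops_add ops_in T S \<eta>)
  have "op_adjoint (L2 \<phi>) T = S"
    unfolding op_adjoint_def
  proof (rule the_equality)
    fix S' assume S': "S' \<in> Ops \<and> (\<forall>\<xi>\<in>E. \<forall>\<eta>\<in>E. ip (T \<xi>) \<eta> = ip \<xi> (S' \<eta>))"
    then show "S' = S"
      using S(1) by (intro ops_eqI L2_eqI_left) (auto simp: ops_in hat_in simp flip: *)
  qed (use S(1) * in blast)
  then show "op_adjoint (L2 \<phi>) T \<in> Ops"
    and "\<And>\<xi> \<eta>. \<xi> \<in> E \<Longrightarrow> \<eta> \<in> E \<Longrightarrow> ip (T \<xi>) \<eta> = ip \<xi> (op_adjoint (L2 \<phi>) T \<eta>)"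
    using S(1) * by auto
qed

lemma gns_expect_adjoint_compose:
  assumes T: "T \<in> Ops"
  shows "gns_expect \<phi> (compose E (op_adjoint (L2 \<phi>) T) T) = complex_of_real ((nm (T (hat 1)))\<^sup>2)"
proof -
  let ?\<xi> = "T (hat 1)" and ?S = "op_adjoint (L2 \<phi>) T"
  have \<xi>: "?\<xi> \<in> E" by (simp add: T ops_in hat_in)
  have "gns_expect \<phi> (compose E ?S T) = ip (?S ?\<xi>) (hat 1)"
    by (simp add: gns_expect_def compose_def hat_in)
  also have "\<dots> = cnj (ip (hat 1) (?S ?\<xi>))"
    by (rule ip_swap) (simp_all add: op_adjoint(1)[OF T] ops_in \<xi> hat_in)
  also have "ip (hat 1) (?S ?\<xi>) = ip ?\<xi> ?\<xi>"
    by (simp add: op_adjoint(2)[OF T] \<xi> hat_in)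
  finally show ?thesis by (simp add: ip_self \<xi>)
qed

section \<open>Extension of maps on A to operators\<close>

text \<open>The bound is in the seminorm of \<phi>, not in the norm of A: it makes \<open>f\<close>
  preserve Cauchy sequences and null sequences, so that \<open>f\<close> descends to
  classes.\<close>

definition bdd_linear :: "('a \<Rightarrow> 'a) \<Rightarrow> bool" where
  "bdd_linear f \<longleftrightarrow> (\<forall>a b. f (a + b) = f a + f b) \<and> (\<forall>c a. f (c *\<^sub>C a) = c *\<^sub>C f a)
     \<and> (\<exists>K. \<forall>a. sn (f a) \<le> K * sn a)"

lemma bdd_linear_diff: "bdd_linear f \<Longrightarrow> f (a - b) = f a - f b"
  unfolding bdd_linear_def by (metis diff_conv_add_uminus scaleC_minus_one)

text \<open>For \<open>bdd_linear f\<close> all members of the union coincide. The restriction to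
  \<open>E\<close> makes the result extensional, as \<open>bounded_ops\<close> demands.\<close>

definition lift :: "('a \<Rightarrow> 'a) \<Rightarrow> (nat \<Rightarrow> 'a) set \<Rightarrow> (nat \<Rightarrow> 'a) set" where
  "lift f = (\<lambda>\<xi>\<in>E. \<Union>x\<in>\<xi>. cls (\<lambda>n. f (x n)))"

lemma Cauchy_bdd_linear:
  assumes "bdd_linear f" "x \<in> Cau"
  shows "(\<lambda>n. f (x n)) \<in> Cau"
proof -
  obtain K where "\<And>a. sn (f a) \<le> K * sn a" using assms(1) by (auto simp: bdd_linear_def)
  then show ?thesis using Cauchy_lift[OF assms(2) bdd_linear_diff[OF assms(1)]] by blast
qed

lemma lift_cls:
  assumes f: "bdd_linear f" and x: "x \<in> Cau"
  shows "lift f (cls x) = cls (\<lambda>n. f (x n))"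
proof -
  obtain K where "\<And>a. sn (f a) \<le> K * sn a" using f by (auto simp: bdd_linear_def)
  then have "congruent (gns_rel \<phi>) (\<lambda>x. cls (\<lambda>n. f (x n)))"
    using cls_lift_cong[OF _ bdd_linear_diff[OF f]] by (intro congruentI) blast
  from UN_equiv_class[OF equiv_rel this x] show ?thesis
    using x by (simp add: lift_def cls_in) (simp add: cls_def)
qed

lemma lift_hat: "bdd_linear f \<Longrightarrow> lift f (hat a) = hat (f a)"
  by (simp add: hat_cls lift_cls Cauchy_const)

lemma nm_lift_le:
  assumes f: "bdd_linear f" and K: "\<And>a. sn (f a) \<le> K * sn a" and \<xi>: "\<xi> \<in> E"
  shows "nm (lift f \<xi>) \<le> K * nm \<xi>"
proof -
  obtain x where x: "x \<in> Cau" "\<xi> = cls x" by (rule E_cases[OF \<xi>])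
  show ?thesis
    unfolding x(2) lift_cls[OF f x(1)]
    by (rule LIMSEQ_le[OF nm_cls[OF Cauchy_bdd_linear[OF f x(1)]] tendsto_mult_left[OF nm_cls[OF x(1)]]])
      (auto simp: K)
qed

lemma lift_ops:
  assumes f: "bdd_linear f"
  shows "lift f \<in> Ops"
proof -
  obtain K where K: "\<And>a. sn (f a) \<le> K * sn a" using f by (auto simp: bdd_linear_def)
  have add: "f (a + b) = f a + f b" and scale: "f (c *\<^sub>C a) = c *\<^sub>C f a" for a b c
    using f by (auto simp: bdd_linear_def)
  show ?thesis
  proof (rule opsI)
    show "nm (lift f \<xi>) \<le> K * nm \<xi>" if "\<xi> \<in> E" for \<xi> by (rule nm_lift_le[OF f K that])
    show "lift f (\<xi> \<oplus>\<^sub>2 \<eta>) = lift f \<xi> \<oplus>\<^sub>2 lift f \<eta>" if \<xi>: "\<xi> \<in> E" and \<eta>: "\<eta> \<in> E" for \<xi> \<eta>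
    proof -
      obtain x where x: "x \<in> Cau" "\<xi> = cls x" by (rule E_cases[OF \<xi>])
      obtain y where y: "y \<in> Cau" "\<eta> = cls y" by (rule E_cases[OF \<eta>])
      show ?thesis
        using x y by (simp add: add_cls lift_cls f Cauchy_bdd_linear Cauchy_add add)
    qed
    fix \<xi> assume \<xi>: "\<xi> \<in> E"
    obtain x where x: "x \<in> Cau" "\<xi> = cls x" by (rule E_cases[OF \<xi>])
    show "lift f \<xi> \<in> E" using x by (simp add: lift_cls f Cauchy_bdd_linear cls_in)
    show "lift f (c \<odot>\<^sub>2 \<xi>) = c \<odot>\<^sub>2 lift f \<xi>" for c
      using x by (simp add: scale_cls lift_cls f Cauchy_bdd_linear Cauchy_scaleC scale)
  qed (simp add: lift_def)
qed

text \<open>Both \<open>gns_rep \<phi> a\<close> and \<open>gns_unitary \<alpha> \<phi> s\<close>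
  have this form, with \<open>f\<close> left multiplication by \<open>a\<close> and
  \<open>f = \<alpha> s\<close>.\<close>

lemma the_extension_eq_lift:
  assumes f: "bdd_linear f"
  shows "(THE T. T \<in> Ops \<and> (\<forall>a. T (hat a) = hat (f a))) = lift f"
  by (rule the_equality) (auto intro!: ops_eqI_on_hat simp: lift_ops lift_hat f)

lemma ip_lift_adjoint:
  assumes f: "bdd_linear f" and g: "bdd_linear g"
    and adj: "\<And>a b. blinfun_apply \<phi> (star b * f a) = blinfun_apply \<phi> (star (g b) * a)"
    and \<xi>: "\<xi> \<in> E" and \<eta>: "\<eta> \<in> E"
  shows "ip (lift f \<xi>) \<eta> = ip \<xi> (lift g \<eta>)"
proof -
  obtain x where x: "x \<in> Cau" "\<xi> = cls x" by (rule E_cases[OF \<xi>])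
  obtain y where y: "y \<in> Cau" "\<eta> = cls y" by (rule E_cases[OF \<eta>])
  show ?thesis
    unfolding x(2) y(2) lift_cls[OF f x(1)] lift_cls[OF g y(1)]
    by (rule ip_eqI) (simp_all add: x y f g Cauchy_bdd_linear adj ip_cls)
qed

section \<open>The GNS representation\<close>

lemma bdd_linear_mult: "bdd_linear (\<lambda>b. a * b)"
  unfolding bdd_linear_def using sn_mult_le[of a] by (auto simp: distrib_left mult_scaleC_right)

lemma gns_rep_eq_lift: "gns_rep \<phi> a = lift (\<lambda>b. a * b)"
  unfolding gns_rep_def by (rule the_extension_eq_lift[OF bdd_linear_mult])

lemma gns_rep_ops: "gns_rep \<phi> a \<in> Ops"
  by (simp add: gns_rep_eq_lift lift_ops bdd_linear_mult)

lemma gns_rep_in: "\<xi> \<in> E \<Longrightarrow> gns_rep \<phi> a \<xi> \<in> E"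
  by (rule ops_in[OF gns_rep_ops])

lemma gns_rep_hat: "gns_rep \<phi> a (hat b) = hat (a * b)"
  by (simp add: gns_rep_eq_lift lift_hat bdd_linear_mult)

lemma gns_rep_adjoint:
  "\<xi> \<in> E \<Longrightarrow> \<eta> \<in> E \<Longrightarrow> ip (gns_rep \<phi> a \<xi>) \<eta> = ip \<xi> (gns_rep \<phi> (star a) \<eta>)"
  unfolding gns_rep_eq_lift
  by (intro ip_lift_adjoint bdd_linear_mult) (simp_all add: star_mult star_star mult.assoc)

lemma nm_gns_rep_le: "\<xi> \<in> E \<Longrightarrow> nm (gns_rep \<phi> a \<xi>) \<le> norm a * nm \<xi>"
  unfolding gns_rep_eq_lift by (intro nm_lift_le bdd_linear_mult sn_mult_le)

lemma Cauchy_mult: "x \<in> Cau \<Longrightarrow> (\<lambda>n. a * x n) \<in> Cau"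
  by (rule Cauchy_bdd_linear[OF bdd_linear_mult])

lemma gns_rep_cls: "x \<in> Cau \<Longrightarrow> gns_rep \<phi> a (cls x) = cls (\<lambda>n. a * x n)"
  by (simp add: gns_rep_eq_lift lift_cls bdd_linear_mult)

lemma gns_rep_add:
  assumes "\<xi> \<in> E" shows "gns_rep \<phi> (a + b) \<xi> = gns_rep \<phi> a \<xi> \<oplus>\<^sub>2 gns_rep \<phi> b \<xi>"
  by (rule E_cases[OF assms]) (simp add: gns_rep_cls add_cls distrib_right Cauchy_mult)

lemma gns_rep_scaleC:
  assumes "\<xi> \<in> E" shows "gns_rep \<phi> (c *\<^sub>C a) \<xi> = c \<odot>\<^sub>2 gns_rep \<phi> a \<xi>"
  by (rule E_cases[OF assms]) (simp add: gns_rep_cls scale_cls mult_scaleC_left Cauchy_mult)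

lemma gns_rep_mult:
  assumes "\<xi> \<in> E" shows "gns_rep \<phi> (a * b) \<xi> = gns_rep \<phi> a (gns_rep \<phi> b \<xi>)"
  by (rule E_cases[OF assms]) (simp add: gns_rep_cls mult.assoc Cauchy_mult)

lemma gns_rep_one:
  assumes "\<xi> \<in> E" shows "gns_rep \<phi> 1 \<xi> = \<xi>"
  by (rule E_cases[OF assms]) (simp add: gns_rep_cls)

end

section \<open>Invariant states\<close>

text \<open>\<open>star_automorphism\<close> does not mention 1, but surjectivity supplies
  \<open>e\<close> with \<open>f e = 1\<close>, and then
  \<open>f 1 = f 1 * f e = f e\<close>.\<close>

lemma star_automorphism_one:
  fixes f :: "'a::cstar_algebra_1 \<Rightarrow> 'a"
  assumes "star_automorphism f"
  shows "f 1 = 1"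
proof -
  obtain e where "f e = 1" using assms unfolding star_automorphism_def by (metis bij_pointE)
  then have "f 1 * 1 = f (1 * e)" using assms unfolding star_automorphism_def by metis
  then show ?thesis using \<open>f e = 1\<close> by simp
qed

locale invariant_gns = gns_state \<phi>
  for \<phi> :: "'a::cstar_algebra_1 \<Rightarrow>\<^sub>L complex" +
  fixes \<Gamma> :: "('g, 'm) monoid_scheme" and \<alpha> :: "'g \<Rightarrow> 'a \<Rightarrow> 'a"
  assumes group: "group \<Gamma>"
    and hom: "\<alpha> \<in> hom \<Gamma> Aut_group"
    and invariant: "\<phi> \<in> invariant_states \<Gamma> \<alpha>"
begin

abbreviation U where "U \<equiv> gns_unitary \<alpha> \<phi>"

lemma automorphism: "s \<in> carrier \<Gamma> \<Longrightarrow> star_automorphism (\<alpha> s)"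
  using hom by (auto simp: hom_def Aut_group_def)

lemma act_mult: "s \<in> carrier \<Gamma> \<Longrightarrow> t \<in> carrier \<Gamma> \<Longrightarrow> \<alpha> (s \<otimes>\<^bsub>\<Gamma>\<^esub> t) a = \<alpha> s (\<alpha> t a)"
  using hom by (auto simp: hom_def Aut_group_def)

text \<open>\<open>hom\<close> only asks for multiplicativity, which makes the action of the neutral
  element idempotent; an injective idempotent map is the identity.\<close>

lemma act_one: "\<alpha> \<one>\<^bsub>\<Gamma>\<^esub> a = a"
proof -
  interpret group \<Gamma> by (rule group)
  have "\<alpha> \<one>\<^bsub>\<Gamma>\<^esub> (\<alpha> \<one>\<^bsub>\<Gamma>\<^esub> a) = \<alpha> \<one>\<^bsub>\<Gamma>\<^esub> a" using act_mult[OF one_closed one_closed, of a] by simp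
  moreover have "inj (\<alpha> \<one>\<^bsub>\<Gamma>\<^esub>)"
    using automorphism[OF one_closed] by (simp add: star_automorphism_def bij_is_inj)
  ultimately show ?thesis by (simp add: inj_eq)
qed

lemma inv_closed: "s \<in> carrier \<Gamma> \<Longrightarrow> inv\<^bsub>\<Gamma>\<^esub> s \<in> carrier \<Gamma>"
  by (rule group.inv_closed[OF group])

lemma inv_act: "s \<in> carrier \<Gamma> \<Longrightarrow> \<alpha> (inv\<^bsub>\<Gamma>\<^esub> s) (\<alpha> s a) = a"
  using act_mult[OF inv_closed, of s s a] group.l_inv[OF group] act_one by simp

lemma act_simps:
  assumes "s \<in> carrier \<Gamma>"
  shows "\<alpha> s (a + b) = \<alpha> s a + \<alpha> s b" "\<alpha> s (c *\<^sub>C a) = c *\<^sub>C \<alpha> s a"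
    "\<alpha> s (a * b) = \<alpha> s a * \<alpha> s b" "\<alpha> s (star a) = star (\<alpha> s a)" "\<alpha> s 1 = 1"
  using automorphism[OF assms] star_automorphism_one[OF automorphism[OF assms]]
  unfolding star_automorphism_def by auto

lemma phi_act: "s \<in> carrier \<Gamma> \<Longrightarrow> blinfun_apply \<phi> (\<alpha> s a) = blinfun_apply \<phi> a"
  using invariant by (simp add: invariant_states_def)

text \<open>Invariance of \<phi> makes \<open>\<alpha> s\<close> isometric for the seminorm, hence
  the constant 1.\<close>

lemma bdd_linear_act: "s \<in> carrier \<Gamma> \<Longrightarrow> bdd_linear (\<alpha> s)"
  unfolding bdd_linear_def
  by (auto simp: act_simps gns_seminorm_def phi_act simp flip: act_simps(3,4) intro!: exI[of _ 1])

lemma U_eq_lift: "s \<in> carrier \<Gamma> \<Longrightarrow> U s = lift (\<alpha> s)"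
  unfolding gns_unitary_def by (rule the_extension_eq_lift[OF bdd_linear_act])

lemma U_ops: "s \<in> carrier \<Gamma> \<Longrightarrow> U s \<in> Ops"
  by (simp add: U_eq_lift lift_ops bdd_linear_act)

lemma U_in: "s \<in> carrier \<Gamma> \<Longrightarrow> \<xi> \<in> E \<Longrightarrow> U s \<xi> \<in> E"
  by (rule ops_in[OF U_ops])

lemma U_hat: "s \<in> carrier \<Gamma> \<Longrightarrow> U s (hat a) = hat (\<alpha> s a)"
  by (simp add: U_eq_lift lift_hat bdd_linear_act)

lemma U_adjoint:
  assumes s: "s \<in> carrier \<Gamma>" and "\<xi> \<in> E" "\<eta> \<in> E"
  shows "ip (U s \<xi>) \<eta> = ip \<xi> (U (inv\<^bsub>\<Gamma>\<^esub> s) \<eta>)"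
proof -
  have "blinfun_apply \<phi> (star b * \<alpha> s a) = blinfun_apply \<phi> (star (\<alpha> (inv\<^bsub>\<Gamma>\<^esub> s) b) * a)" for a b
    using phi_act[OF inv_closed[OF s], of "star b * \<alpha> s a"] s
    by (simp add: act_simps inv_closed inv_act)
  then show ?thesis
    using assms by (simp add: U_eq_lift inv_closed ip_lift_adjoint bdd_linear_act)
qed

lemma inv_U:
  assumes s: "s \<in> carrier \<Gamma>" and \<xi>: "\<xi> \<in> E"
  shows "U (inv\<^bsub>\<Gamma>\<^esub> s) (U s \<xi>) = \<xi>"
  by (rule E_cases[OF \<xi>])
    (simp add: U_eq_lift s inv_closed lift_cls bdd_linear_act Cauchy_bdd_linear inv_act)

lemma ip_U: "s \<in> carrier \<Gamma> \<Longrightarrow> \<xi> \<in> E \<Longrightarrow> \<eta> \<in> E \<Longrightarrow> ip (U s \<xi>) (U s \<eta>) = ip \<xi> \<eta>"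
  by (simp add: U_adjoint U_in inv_U)


section \<open>Consequences of ergodicity\<close>

text \<open>If \<open>\<omega> \<le> C\<phi>\<close> then \<open>\<phi>\<close> is a proper convex combination of \<open>\<omega>\<close> and a remainder state.\<close>

lemma ergodic_dominated_eq:
  assumes erg: "ergodic_state \<Gamma> \<alpha> \<phi>" and \<omega>: "\<omega> \<in> invariant_states \<Gamma> \<alpha>"
    and le: "\<And>a. Re (blinfun_apply \<omega> (star a * a)) \<le> C * Re (blinfun_apply \<phi> (star a * a))"
  shows "\<omega> = \<phi>"
proof -
  interpret c: gns_state \<omega> by unfold_locales (use \<omega> in \<open>simp add: invariant_states_def\<close>)
  \<comment> \<open>\<open>t * \<bar>C\<bar> \<le> 1\<close> makes
    \<open>\<phi> - t *\<^sub>R \<omega>\<close> positive; adding 2 instead of 1 keeps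
    \<open>t < 1\<close> also for \<open>C = 0\<close>.\<close>
  define t where "t = 1 / (\<bar>C\<bar> + 2)"
  have t: "0 < t" "t < 1" "t * \<bar>C\<bar> \<le> 1" by (simp_all add: t_def)
  then have t': "1 - complex_of_real t \<noteq> 0"
    by (metis eq_iff_diff_eq_0 less_irrefl of_real_1 of_real_eq_iff)
  define \<rho> where "\<rho> = (1 / (1 - t)) *\<^sub>R (\<phi> - t *\<^sub>R \<omega>)"
  have \<rho>: "blinfun_apply \<rho> a = complex_of_real (1 / (1 - t))
      * (blinfun_apply \<phi> a - complex_of_real t * blinfun_apply \<omega> a)" for a
    by (simp add: \<rho>_def blinfun.scaleR_left blinfun.diff_left scaleR_conv_of_real)
  have "is_state \<rho>"
    unfolding is_state_def
  proof (intro conjI allI)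
    show "blinfun_apply \<rho> (c *\<^sub>C a) = c * blinfun_apply \<rho> a" for c a
      by (simp add: \<rho> phi_scaleC c.phi_scaleC algebra_simps)
    show "blinfun_apply \<rho> 1 = 1"
      using t' by (simp add: \<rho> phi_one c.phi_one)
    fix a
    have "t * (c.sn a)\<^sup>2 \<le> t * (\<bar>C\<bar> * (sn a)\<^sup>2)"
    proof (rule mult_left_mono)
      have "(c.sn a)\<^sup>2 \<le> C * (sn a)\<^sup>2" using le[of a] by (simp add: sn_square c.sn_square)
      also have "\<dots> \<le> \<bar>C\<bar> * (sn a)\<^sup>2" by (intro mult_right_mono) simp_all
      finally show "(c.sn a)\<^sup>2 \<le> \<bar>C\<bar> * (sn a)\<^sup>2" .
    qed (use t in simp)
    also have "\<dots> \<le> (sn a)\<^sup>2"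
      using mult_right_mono[OF t(3) zero_le_power2[of "sn a"]] by (simp add: mult.assoc)
    finally have "0 \<le> (1 / (1 - t)) * ((sn a)\<^sup>2 - t * (c.sn a)\<^sup>2)" using t by simp
    moreover have "blinfun_apply \<rho> (star a * a) = complex_of_real ((1 / (1 - t)) * ((sn a)\<^sup>2 - t * (c.sn a)\<^sup>2))"
      by (simp add: \<rho> phi_star_mult_self c.phi_star_mult_self)
    ultimately show "blinfun_apply \<rho> (star a * a) \<in> \<real>\<^sub>\<ge>\<^sub>0"
      by (simp only: nonneg_Reals_of_real_iff)
  qed
  then have \<rho>_in: "\<rho> \<in> invariant_states \<Gamma> \<alpha>"
    using \<omega> invariant by (simp add: invariant_states_def \<rho>)
  have comb: "\<phi> = (1 - t) *\<^sub>R \<rho> + t *\<^sub>R \<omega>"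
    using t by (simp add: \<rho>_def)
  moreover have "\<phi> \<notin> open_segment \<rho> \<omega>"
    using erg \<rho>_in \<omega> by (auto simp: ergodic_state_def extreme_point_of_def)
  \<comment> \<open>An open segment has distinct end points. As \<phi> is a proper combination of
    \<rho> and \<omega> but lies in no such segment, they coincide.\<close>
  ultimately have "\<rho> = \<omega>"
    using t unfolding in_segment by blast
  with comb show ?thesis by (simp flip: scaleR_add_left)
qed

text \<open>Normalising \<open>\<phi> + \<psi>\<close> rather than \<open>\<psi>(a) = \<langle>\<pi>(a)\<xi>, \<xi>\<rangle>\<close> avoids the case \<open>\<xi> = 0\<close>.\<close>

lemma ergodic_vector_functional:
  assumes erg: "ergodic_state \<Gamma> \<alpha> \<phi>" and \<xi>: "\<xi> \<in> E"
    and bd: "\<And>a. nm (gns_rep \<phi> a \<xi>) \<le> K * sn a"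
    and inv: "\<And>s a. s \<in> carrier \<Gamma> \<Longrightarrow> ip (gns_rep \<phi> (\<alpha> s a) \<xi>) \<xi> = ip (gns_rep \<phi> a \<xi>) \<xi>"
  shows "ip (gns_rep \<phi> a \<xi>) \<xi> = complex_of_real ((nm \<xi>)\<^sup>2) * blinfun_apply \<phi> a"
proof -
  define \<psi> where "\<psi> a = ip (gns_rep \<phi> a \<xi>) \<xi>" for a
  define m where "m = (nm \<xi>)\<^sup>2"
  have m: "1 + m > 0" by (simp add: m_def add_pos_nonneg)
  then have m': "1 + complex_of_real m \<noteq> 0"
    by (metis less_irrefl of_real_1 of_real_add of_real_eq_0_iff)
  have \<psi>_self: "\<psi> (star a * a) = complex_of_real ((nm (gns_rep \<phi> a \<xi>))\<^sup>2)" for a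
    using gns_rep_adjoint[OF gns_rep_in[OF \<xi>] \<xi>, of "star a" a] \<xi>
    by (simp add: \<psi>_def gns_rep_mult star_star ip_self gns_rep_in)
  have \<psi>_add: "\<psi> (a + b) = \<psi> a + \<psi> b" for a b
    using \<xi> by (simp add: \<psi>_def gns_rep_add gns_rep_in ip_add_left)
  have \<psi>_scaleC: "\<psi> (c *\<^sub>C a) = c * \<psi> a" for c a
    using \<xi> by (simp add: \<psi>_def gns_rep_scaleC gns_rep_in ip_scale_left)
  \<comment> \<open>States are bounded linear maps here, so \<psi> needs a bound in the norm of A;
    contractivity of the representation gives the constant \<open>m\<close>.\<close>
  have "bounded_linear \<psi>"
  proof (rule bounded_linear_intro)
    show "\<psi> (r *\<^sub>R a) = r *\<^sub>R \<psi> a" for r a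
      using \<psi>_scaleC[of "complex_of_real r" a] by (simp add: scaleC_of_real scaleR_conv_of_real)
    show "norm (\<psi> a) \<le> norm a * m" for a
      using L2_Cauchy_Schwarz[OF gns_rep_in[OF \<xi>] \<xi>, of a]
        mult_right_mono[OF nm_gns_rep_le[OF \<xi>, of a] nm_nonneg[OF \<xi>]]
      by (simp add: \<psi>_def m_def power2_eq_square)
  qed (rule \<psi>_add)
  note [simp] = bounded_linear_Blinfun_apply[OF this]
  \<comment> \<open>\<open>1 + m\<close> is the value of \<open>\<phi> + \<psi>\<close> at
    1.\<close>
  define \<omega> where "\<omega> = (1 / (1 + m)) *\<^sub>R (\<phi> + Blinfun \<psi>)"
  have \<omega>: "blinfun_apply \<omega> a = complex_of_real (1 / (1 + m)) * (blinfun_apply \<phi> a + \<psi> a)" for a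
    by (simp add: \<omega>_def blinfun.scaleR_left blinfun.add_left scaleR_conv_of_real)
  have \<omega>_self: "blinfun_apply \<omega> (star a * a)
      = complex_of_real ((1 / (1 + m)) * ((sn a)\<^sup>2 + (nm (gns_rep \<phi> a \<xi>))\<^sup>2))" for a
    by (simp add: \<omega> phi_star_mult_self \<psi>_self)
  have \<psi>_one: "\<psi> 1 = complex_of_real m"
    using \<xi> by (simp add: \<psi>_def m_def gns_rep_one ip_self)
  have "is_state \<omega>"
    unfolding is_state_def
  proof (intro conjI allI)
    show "blinfun_apply \<omega> (c *\<^sub>C a) = c * blinfun_apply \<omega> a" for c a
      by (simp add: \<omega> phi_scaleC \<psi>_scaleC algebra_simps add_divide_distrib)
    show "blinfun_apply \<omega> 1 = 1"
      using m' by (simp add: \<omega> phi_one \<psi>_one)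
    show "blinfun_apply \<omega> (star a * a) \<in> \<real>\<^sub>\<ge>\<^sub>0" for a
      unfolding \<omega>_self nonneg_Reals_of_real_iff using m by simp
  qed
  then have \<omega>_in: "\<omega> \<in> invariant_states \<Gamma> \<alpha>"
    using invariant inv by (simp add: invariant_states_def \<omega> \<psi>_def)
  have "\<omega> = \<phi>"
  proof (rule ergodic_dominated_eq[OF erg \<omega>_in])
    fix a
    have "(nm (gns_rep \<phi> a \<xi>))\<^sup>2 \<le> (K * sn a)\<^sup>2"
      by (intro power_mono bd nm_nonneg gns_rep_in \<xi>)
    then have "(sn a)\<^sup>2 + (nm (gns_rep \<phi> a \<xi>))\<^sup>2 \<le> (1 + K\<^sup>2) * (sn a)\<^sup>2"
      by (simp add: power_mult_distrib algebra_simps)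
    then have "(1 / (1 + m)) * ((sn a)\<^sup>2 + (nm (gns_rep \<phi> a \<xi>))\<^sup>2) \<le> (1 / (1 + m)) * ((1 + K\<^sup>2) * (sn a)\<^sup>2)"
      using m by (intro mult_left_mono) simp_all
    then show "Re (blinfun_apply \<omega> (star a * a)) \<le> (1 / (1 + m) * (1 + K\<^sup>2)) * Re (blinfun_apply \<phi> (star a * a))"
      unfolding \<omega>_self phi_star_mult_self Re_complex_of_real by (simp only: mult.assoc)
  qed
  then have "(1 + complex_of_real m) * blinfun_apply \<phi> a = blinfun_apply \<phi> a + \<psi> a"
    using \<omega>[of a] m' by (simp add: nonzero_eq_divide_eq mult.commute)
  then show ?thesis by (simp add: \<psi>_def m_def algebra_simps)
qed

lemma ergodic_imp_expect:
  assumes erg: "ergodic_state \<Gamma> \<alpha> \<phi>"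
    and T: "T \<in> invariant_ops \<Gamma> \<alpha> \<phi> \<inter> gns_commutant \<phi>"
  shows "(nm (T (hat 1)))\<^sup>2 = (cmod (gns_expect \<phi> T))\<^sup>2"
proof -
  have ops: "T \<in> Ops" using T by (simp add: gns_commutant_def)
  have comm: "T (gns_rep \<phi> a \<xi>) = gns_rep \<phi> a (T \<xi>)" if "\<xi> \<in> E" for a \<xi>
    using T that by (simp add: gns_commutant_def)
  let ?\<eta> = "T (hat 1)" and ?x = "gns_expect \<phi> T"
  have \<eta>: "?\<eta> \<in> E" and Tin: "T (hat a) \<in> E" for a by (simp_all add: ops_in ops hat_in)
  have rep: "gns_rep \<phi> a ?\<eta> = T (hat a)" for a
    using comm[OF hat_in, of a 1] by (simp add: gns_rep_hat)
  have UT: "U s (T (hat a)) = T (hat (\<alpha> s a))" if s: "s \<in> carrier \<Gamma>" for s a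
  proof -
    \<comment> \<open>Invariance of \<open>T\<close> is used at \<open>hat (\<alpha> s a)\<close>,
      which the inner unitary sends back to \<open>hat a\<close>.\<close>
    have "U s (T (U (inv\<^bsub>\<Gamma>\<^esub> s) (hat (\<alpha> s a)))) = T (hat (\<alpha> s a))"
      using T s hat_in by (simp add: invariant_ops_def)
    then show ?thesis by (simp add: U_hat s inv_closed inv_act)
  qed
  obtain K where K: "K \<ge> 0" "\<And>\<xi>. \<xi> \<in> E \<Longrightarrow> nm (T \<xi>) \<le> K * nm \<xi>" by (rule ops_bound[OF ops]) blast
  define \<xi> where "\<xi> c = ?\<eta> \<oplus>\<^sub>2 c \<odot>\<^sub>2 hat 1" for c
  have \<xi>: "\<xi> c \<in> E" for c by (simp add: \<xi>_def add_in scale_in \<eta> hat_in)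
  have rep_\<xi>: "gns_rep \<phi> a (\<xi> c) = T (hat a) \<oplus>\<^sub>2 c \<odot>\<^sub>2 hat a" for a c
    by (simp add: \<xi>_def ops_add[OF gns_rep_ops] ops_scale[OF gns_rep_ops] rep gns_rep_hat
        \<eta> hat_in scale_in)
  have "ip (gns_rep \<phi> a (\<xi> c)) (\<xi> c) = complex_of_real ((nm (\<xi> c))\<^sup>2) * blinfun_apply \<phi> a" for a c
  proof (rule ergodic_vector_functional[OF erg \<xi>])
    show "nm (gns_rep \<phi> a (\<xi> c)) \<le> (K + cmod c) * sn a" for a
      using nm_triangle[OF Tin scale_in[OF hat_in], of a c a] K(2)[OF hat_in, of a]
      by (simp add: rep_\<xi> nm_scale hat_in nm_hat distrib_right)
    fix s a assume s: "s \<in> carrier \<Gamma>"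
    have "gns_rep \<phi> (\<alpha> s a) (\<xi> c) = U s (gns_rep \<phi> a (\<xi> c))" for a
      by (simp add: rep_\<xi> UT s U_hat ops_add[OF U_ops] ops_scale[OF U_ops] Tin hat_in scale_in)
    \<comment> \<open>The case \<open>a = 1\<close> shows that \<open>\<xi> c\<close> is fixed by
      \<open>U s\<close>, so \<open>U s\<close> can be put on both entries of the inner product and
      removed by \<open>ip_U\<close>.\<close>
    moreover from this[of 1] have "\<xi> c = U s (\<xi> c)"
      using s by (simp add: act_simps gns_rep_one \<xi>)
    ultimately show "ip (gns_rep \<phi> (\<alpha> s a) (\<xi> c)) (\<xi> c) = ip (gns_rep \<phi> a (\<xi> c)) (\<xi> c)"
      using ip_U[OF s gns_rep_in[OF \<xi>] \<xi>, of a c c] by simp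
  qed
  then have vec: "ip (T (hat a) \<oplus>\<^sub>2 c \<odot>\<^sub>2 hat a) (\<xi> c) = ip (\<xi> c) (\<xi> c) * blinfun_apply \<phi> a" for a c
    by (simp add: rep_\<xi> ip_self \<xi>)
  have expand: "ip (T (hat a) \<oplus>\<^sub>2 c \<odot>\<^sub>2 hat a) (\<xi> c)
      = ip (T (hat a)) ?\<eta> + cnj c * ip (T (hat a)) (hat 1) + c * ip (hat a) ?\<eta>
        + c * cnj c * blinfun_apply \<phi> a" for a c
    by (simp add: \<xi>_def ip_add_left ip_add_right ip_scale_left ip_scale_right add_in scale_in
        Tin hat_in ip_hat star_one algebra_simps)
  have polar: "ip (T (hat a)) (hat 1) = ?x * blinfun_apply \<phi> a" for a
  proof -
    \<comment> \<open>Subtracting \<open>blinfun_apply \<phi> a\<close> times the expansion at 1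
      from the expansion at \<open>a\<close> cancels the terms in \<open>c * cnj c\<close>. What
      remains has \<open>?X\<close>, \<open>?Y\<close> and \<open>?Z\<close> as coefficients of
      \<open>cnj c\<close>, \<open>c\<close> and 1; the values 0, 1 and \<open>\<i>\<close> of
      \<open>c\<close> separate them.\<close>
    let ?X = "ip (T (hat a)) (hat 1) - ?x * blinfun_apply \<phi> a"
    let ?Y = "ip (hat a) ?\<eta> - ip (hat 1) ?\<eta> * blinfun_apply \<phi> a"
    let ?Z = "ip (T (hat a)) ?\<eta> - ip ?\<eta> ?\<eta> * blinfun_apply \<phi> a"
    have eq: "?Z + cnj c * ?X + c * ?Y = 0" for c
      using vec[of a c] expand[of a c] expand[of 1 c]
      by (simp add: \<xi>_def[symmetric] gns_expect_def phi_one algebra_simps)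
    have "?X + ?Y = 0" using eq[of 0] eq[of 1] by simp
    moreover have "- \<i> * ?X + \<i> * ?Y = 0" using eq[of 0] eq[of \<i>] by simp
    then have "\<i> * (?Y - ?X) = 0" by (simp add: algebra_simps)
    then have "?Y = ?X" by simp
    ultimately show ?thesis by simp
  qed
  have "?\<eta> = ?x \<odot>\<^sub>2 hat 1"
  proof (rule L2_eqI[OF \<eta> scale_in[OF hat_in]])
    fix b
    \<comment> \<open>\<open>polar\<close> tests only against \<open>hat 1\<close>, so
      \<open>b\<close> is moved to the left entry as \<open>star b\<close>; the double star fits
      \<open>gns_rep_adjoint\<close> read backwards.\<close>
    have "ip ?\<eta> (hat b) = ip ?\<eta> (gns_rep \<phi> (star (star b)) (hat 1))"
      by (simp add: gns_rep_hat star_star)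
    also have "\<dots> = ip (gns_rep \<phi> (star b) ?\<eta>) (hat 1)"
      by (rule gns_rep_adjoint[symmetric]) (simp_all add: \<eta> hat_in)
    also have "\<dots> = ?x * blinfun_apply \<phi> (star b)" by (simp add: rep polar)
    also have "\<dots> = ip (?x \<odot>\<^sub>2 hat 1) (hat b)"
      by (simp add: ip_scale_left hat_in ip_hat)
    finally show "ip ?\<eta> (hat b) = ip (?x \<odot>\<^sub>2 hat 1) (hat b)" .
  qed
  then have "nm ?\<eta> = cmod ?x * nm (hat 1)" using nm_scale[OF hat_in] by simp
  then show ?thesis by (simp add: nm_hat gns_seminorm_def star_one phi_one)
qed

section \<open>Consequences of the expectation identity\<close>

text \<open>A state \<open>\<omega> \<le> C\<phi>\<close> has a Radon-Nikodym derivative \<open>T\<close> with \<open>\<omega>(b\<^sup>*a) = \<langle>T a, b\<rangle>\<close>; the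
  hypothesis says that equality holds in the Cauchy-Schwarz inequality for \<open>T 1\<close> and \<open>1\<close>.\<close>

lemma expect_imp_dominated_eq:
  assumes expect: "\<And>T. T \<in> invariant_ops \<Gamma> \<alpha> \<phi> \<inter> gns_commutant \<phi> \<Longrightarrow>
      (nm (T (hat 1)))\<^sup>2 = (cmod (gns_expect \<phi> T))\<^sup>2"
    and \<omega>: "\<omega> \<in> invariant_states \<Gamma> \<alpha>"
    and le: "\<And>a. Re (blinfun_apply \<omega> (star a * a)) \<le> C * Re (blinfun_apply \<phi> (star a * a))"
  shows "\<omega> = \<phi>"
proof -
  interpret c: invariant_gns \<omega> \<Gamma> \<alpha>
    by (intro invariant_gns.intro gns_state.intro invariant_gns_axioms.intro)
      (use \<omega> group hom in \<open>simp_all add: invariant_states_def\<close>)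
  have C: "C \<ge> 0"
    using le[of 1] by (simp add: star_one phi_one c.phi_one)
  have sn_le: "c.sn a \<le> sqrt C * sn a" for a
  proof -
    have "(c.sn a)\<^sup>2 \<le> (sqrt C * sn a)\<^sup>2"
      using le[of a] C by (simp add: c.sn_square sn_square power_mult_distrib flip: sn_square)
    then show ?thesis by (rule power2_le_imp_le) (simp add: C sn_nonneg)
  qed
  \<comment> \<open>Cauchy-Schwarz for \<omega>; each of its two seminorms costs a factor
    \<open>sqrt C\<close>.\<close>
  have form_le: "cmod (blinfun_apply \<omega> (star b * a)) \<le> (C * sn b) * sn a" for a b
  proof -
    have "c.sn b * c.sn a \<le> (sqrt C * sn b) * (sqrt C * sn a)"
      using C by (intro mult_mono sn_le) (simp_all add: sn_nonneg c.sn_nonneg)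
    also have "\<dots> = (sqrt C * sqrt C) * (sn b * sn a)" by (simp only: ac_simps)
    also have "sqrt C * sqrt C = C" using C by simp
    finally have "c.sn b * c.sn a \<le> C * (sn b * sn a)" .
    then show ?thesis
      using c.Cauchy_Schwarz[of b a] by (simp add: mult.assoc)
  qed
  \<comment> \<open>The form is represented in its linear variable \<open>a\<close>. It is conjugate
    linear in \<open>b\<close>, and so is the passage from a functional to its vector, so the vector
    depends linearly on \<open>b\<close>.\<close>
  have "\<exists>\<zeta>. \<zeta> \<in> E \<and> nm \<zeta> \<le> C * sn b \<and> (\<forall>a. ip (hat a) \<zeta> = blinfun_apply \<omega> (star b * a))" for b
  proof (rule Riesz[of "\<lambda>a. blinfun_apply \<omega> (star b * a)" "C * sn b"])
    show "cmod (blinfun_apply \<omega> (star b * a)) \<le> C * sn b * sn a" for a by (rule form_le)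
  qed (auto simp: distrib_left c.phi_add mult_scaleC_right c.phi_scaleC)
  then obtain R where R: "\<And>b. R b \<in> E" "\<And>b. nm (R b) \<le> C * sn b"
    "\<And>a b. ip (hat a) (R b) = blinfun_apply \<omega> (star b * a)"
    by metis
  obtain T where T: "T \<in> Ops" "\<And>\<xi> b. \<xi> \<in> E \<Longrightarrow> ip (T \<xi>) (hat b) = ip \<xi> (R b)"
  proof (rule ex_op_of_sesquilinear[of R C])
    show "R (a + b) = R a \<oplus>\<^sub>2 R b" for a b
      by (rule L2_eqI_left) (simp_all add: R add_in ip_add_right hat_in star_add distrib_right c.phi_add)
    show "R (c *\<^sub>C a) = c \<odot>\<^sub>2 R a" for c a
      by (rule L2_eqI_left) (simp_all add: R scale_in ip_scale_right hat_in star_scaleC mult_scaleC_left c.phi_scaleC)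
  qed (simp_all add: R)
  have "T \<in> gns_commutant \<phi>"
  proof -
    have "T (gns_rep \<phi> a \<xi>) = gns_rep \<phi> a (T \<xi>)" if \<xi>: "\<xi> \<in> E" for a \<xi>
    proof (rule L2_eqI)
      fix b
      \<comment> \<open>Commutation is checked on the vectors \<open>R b\<close>, where it is
        associativity: both sides pair with \<open>hat d\<close> to the value of \<omega> at
        \<open>star b * a * d\<close>.\<close>
      have "R (star a * b) = gns_rep \<phi> (star a) (R b)"
      proof (rule L2_eqI_left)
        fix d
        have "ip (hat d) (gns_rep \<phi> (star a) (R b)) = ip (gns_rep \<phi> a (hat d)) (R b)"
          by (rule gns_rep_adjoint[symmetric]) (simp_all add: R hat_in)
        then show "ip (hat d) (R (star a * b)) = ip (hat d) (gns_rep \<phi> (star a) (R b))"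
          by (simp add: gns_rep_hat R star_mult star_star mult.assoc)
      qed (simp_all add: R gns_rep_in)
      then show "ip (T (gns_rep \<phi> a \<xi>)) (hat b) = ip (gns_rep \<phi> a (T \<xi>)) (hat b)"
        by (simp add: T \<xi> gns_rep_in gns_rep_adjoint R hat_in ops_in gns_rep_hat)
    qed (simp_all add: T ops_in gns_rep_in \<xi>)
    then show ?thesis using T(1) by (simp add: gns_commutant_def)
  qed
  moreover have "T \<in> invariant_ops \<Gamma> \<alpha> \<phi>"
  proof -
    have "U s (T (U (inv\<^bsub>\<Gamma>\<^esub> s) \<xi>)) = T \<xi>" if s: "s \<in> carrier \<Gamma>" and \<xi>: "\<xi> \<in> E" for s \<xi>
    proof (rule L2_eqI)
      let ?s' = "inv\<^bsub>\<Gamma>\<^esub> s"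
      have s': "?s' \<in> carrier \<Gamma>" "inv\<^bsub>\<Gamma>\<^esub> ?s' = s"
        using s group.inv_inv[OF group] by (simp_all add: inv_closed)
      fix b
      \<comment> \<open>Invariance of \<omega> in terms of the vectors \<open>R b\<close>: they are
        carried into each other by the unitaries.\<close>
      have R': "U s (R (\<alpha> ?s' b)) = R b"
      proof (rule L2_eqI_left)
        fix d
        have "ip (hat d) (U s (R (\<alpha> ?s' b))) = ip (U ?s' (hat d)) (R (\<alpha> ?s' b))"
          by (simp add: U_adjoint s' hat_in R)
        also have "\<dots> = blinfun_apply \<omega> (\<alpha> ?s' (star b * d))"
          by (simp add: U_hat s' R act_simps)
        finally show "ip (hat d) (U s (R (\<alpha> ?s' b))) = ip (hat d) (R b)"
          by (simp add: c.phi_act s' R)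
      qed (simp_all add: R U_in s)
      have "ip (U s (T (U ?s' \<xi>))) (hat b) = ip (U ?s' \<xi>) (R (\<alpha> ?s' b))"
        by (simp add: U_adjoint[OF s] T U_in s' \<xi> ops_in hat_in U_hat)
      also have "\<dots> = ip \<xi> (R b)"
        by (simp add: U_adjoint[OF s'(1)] s'(2) R R' \<xi>)
      finally show "ip (U s (T (U ?s' \<xi>))) (hat b) = ip (T \<xi>) (hat b)"
        by (simp add: T \<xi>)
    qed (simp_all add: T ops_in U_in s inv_closed \<xi>)
    then show ?thesis using T(1) by (simp add: invariant_ops_def)
  qed
  ultimately have "(nm (T (hat 1)))\<^sup>2 = (cmod (gns_expect \<phi> T))\<^sup>2" using expect by blast
  moreover have hat1: "ip (T (hat 1)) (hat b) = blinfun_apply \<omega> (star b)" for b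
    by (simp add: T hat_in R)
  then have ip1: "ip (T (hat 1)) (hat 1) = 1" by (simp add: star_one c.phi_one)
  ultimately have nm1: "(nm (T (hat 1)))\<^sup>2 = 1" by (simp add: gns_expect_def)
  have "T (hat 1) = hat 1"
  proof (rule L2_diff_zero_imp_eq)
    let ?d = "T (hat 1) \<oplus>\<^sub>2 (-1) \<odot>\<^sub>2 hat 1"
    have in_E: "T (hat 1) \<in> E" "hat 1 \<in> E" "?d \<in> E" by (simp_all add: T ops_in hat_in add_in scale_in)
    have "ip (hat 1) (T (hat 1)) = 1" using ip1 ip_swap[OF in_E(1,2)] by simp
    \<comment> \<open>Both squared norms and both mixed products are 1, so the squared distance is 1
      - 1 - 1 + 1.\<close>
    then have "ip ?d ?d = 0"
      using in_E nm1 ip_self[OF in_E(1)] ip1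
      by (simp add: ip_add_left ip_add_right ip_scale_left ip_scale_right scale_in add_in
          ip_hat star_one phi_one)
    then show "nm ?d = 0" using ip_self[OF in_E(3)] by simp
  qed (simp_all add: T ops_in hat_in)
  then have "blinfun_apply \<omega> (star b) = blinfun_apply \<phi> (star b)" for b
    using hat1[of b] by (simp add: ip_hat)
  then have "blinfun_apply \<omega> a = blinfun_apply \<phi> a" for a
    by (metis star_star)
  then show ?thesis by (rule blinfun_eqI)
qed

text \<open>In \<open>(1 - u) *\<^sub>R \<omega> + u *\<^sub>R \<rho>\<close> each summand is at
  most \<phi> on positive elements, so \<omega> and \<rho> are dominated with constants
  \<open>1 / (1 - u)\<close> and \<open>1 / u\<close>. Both then equal \<phi>, against the
  distinctness of the end points.\<close>

lemma dominated_eq_imp_ergodic: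
  assumes eq: "\<And>\<omega> C. \<omega> \<in> invariant_states \<Gamma> \<alpha> \<Longrightarrow>
      (\<And>a. Re (blinfun_apply \<omega> (star a * a)) \<le> C * Re (blinfun_apply \<phi> (star a * a))) \<Longrightarrow> \<omega> = \<phi>"
  shows "ergodic_state \<Gamma> \<alpha> \<phi>"
  unfolding ergodic_state_def extreme_point_of_def
proof (intro conjI ballI notI)
  fix \<omega> \<rho> assume \<omega>: "\<omega> \<in> invariant_states \<Gamma> \<alpha>" and \<rho>: "\<rho> \<in> invariant_states \<Gamma> \<alpha>"
    and seg: "\<phi> \<in> open_segment \<omega> \<rho>"
  then obtain u where u: "\<omega> \<noteq> \<rho>" "0 < u" "u < 1" "\<phi> = (1 - u) *\<^sub>R \<omega> + u *\<^sub>R \<rho>"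
    by (auto simp: in_segment)
  interpret c: gns_state \<omega> by unfold_locales (use \<omega> in \<open>simp add: invariant_states_def\<close>)
  interpret r: gns_state \<rho> by unfold_locales (use \<rho> in \<open>simp add: invariant_states_def\<close>)
  have comb: "Re (blinfun_apply \<phi> (star a * a)) = (1 - u) * (c.sn a)\<^sup>2 + u * (r.sn a)\<^sup>2" for a
    by (simp add: u(4) blinfun.add_left blinfun.scaleR_left c.sn_square r.sn_square)
  have "\<omega> = \<phi>"
  proof (rule eq[OF \<omega>])
    have "(1 - u) * (c.sn a)\<^sup>2 \<le> Re (blinfun_apply \<phi> (star a * a))" for a
      using u comb[of a] by simp
    then show "Re (blinfun_apply \<omega> (star a * a)) \<le> 1 / (1 - u) * Re (blinfun_apply \<phi> (star a * a))" for a
      using u by (simp add: pos_le_divide_eq mult.commute flip: c.sn_square)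
  qed
  moreover have "\<rho> = \<phi>"
  proof (rule eq[OF \<rho>])
    have "u * (r.sn a)\<^sup>2 \<le> Re (blinfun_apply \<phi> (star a * a))" for a
      using u comb[of a] by simp
    then show "Re (blinfun_apply \<rho> (star a * a)) \<le> 1 / u * Re (blinfun_apply \<phi> (star a * a))" for a
      using u by (simp add: pos_le_divide_eq mult.commute flip: r.sn_square)
  qed
  ultimately show False using u(1) by simp
qed (rule invariant)

end

theorem proposition3p7:
  fixes \<Gamma> :: "('g, 'm) monoid_scheme"
    and \<alpha> :: "'g \<Rightarrow> 'a::cstar_algebra_1 \<Rightarrow> 'a"
    and \<phi> :: "'a \<Rightarrow>\<^sub>L complex"
  assumes "group \<Gamma>"
    and "\<alpha> \<in> hom \<Gamma> Aut_group"
    and "\<phi> \<in> invariant_states \<Gamma> \<alpha>"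
  shows "ergodic_state \<Gamma> \<alpha> \<phi> \<longleftrightarrow>
    (\<forall>T \<in> invariant_ops \<Gamma> \<alpha> \<phi> \<inter> gns_commutant \<phi>.
       gns_expect \<phi> (compose (carrier (L2 \<phi>)) (op_adjoint (L2 \<phi>) T) T)
         = complex_of_real ((cmod (gns_expect \<phi> T))\<^sup>2))"
proof -
  interpret invariant_gns \<phi> \<Gamma> \<alpha>
    by (intro invariant_gns.intro gns_state.intro invariant_gns_axioms.intro)
      (use assms in \<open>simp_all add: invariant_states_def\<close>)
  have *: "gns_expect \<phi> (compose E (op_adjoint (L2 \<phi>) T) T) = complex_of_real ((cmod (gns_expect \<phi> T))\<^sup>2)
      \<longleftrightarrow> (nm (T (hat 1)))\<^sup>2 = (cmod (gns_expect \<phi> T))\<^sup>2"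
    if "T \<in> invariant_ops \<Gamma> \<alpha> \<phi> \<inter> gns_commutant \<phi>" for T
    using that by (subst gns_expect_adjoint_compose) (simp_all only: gns_commutant_def of_real_eq_iff Int_iff mem_Collect_eq)
  show ?thesis
  proof
    assume "ergodic_state \<Gamma> \<alpha> \<phi>"
    then show "\<forall>T \<in> invariant_ops \<Gamma> \<alpha> \<phi> \<inter> gns_commutant \<phi>.
        gns_expect \<phi> (compose E (op_adjoint (L2 \<phi>) T) T) = complex_of_real ((cmod (gns_expect \<phi> T))\<^sup>2)"
      using * ergodic_imp_expect by blast
  next
    assume "\<forall>T \<in> invariant_ops \<Gamma> \<alpha> \<phi> \<inter> gns_commutant \<phi>.
        gns_expect \<phi> (compose E (op_adjoint (L2 \<phi>) T) T) = complex_of_real ((cmod (gns_expect \<phi> T))\<^sup>2)"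
    then show "ergodic_state \<Gamma> \<alpha> \<phi>"
      by (intro dominated_eq_imp_ergodic expect_imp_dominated_eq) (use * in blast)
  qed
qed

end
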